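(* Let the functions $\alpha_k(s)$ ($k=0,1,2,\ldots$, $s\in\mathbb{C}$) be defined by the Taylor expansion $$\left(\frac{-\log(1-t)}{t}\right)^{s-1}=\sum_{k=0}^\infty \alpha_k(s)\,t^k,\qquad |t|<1.$$ Then the following identities hold (with convergent series). (i) For all $s\in\mathbb{C}\setminus\{0,-1,-2,\ldots\}$, $$\Gamma(s)=\sum_{k=0}^\infty\frac{\alpha_k(s)}{s+k}.$$ (ii) For all $s\in\mathbb{C}\setminus\{1,0,-1,-2,\ldots\}$, $$\Gamma(s)\zeta(s)=\sum_{k=0}^\infty\frac{\alpha_k(s)}{s+k-1}.$$ (iii) For every positive integer $\lambda$ and all $s\in\mathbb{C}$ that are not integers $\le \lambda+1$, $$\Gamma(s)\zeta(s-\lambda)=\sum_{k=0}^\infty\alpha_k(s)\sum_{j=1}^\lambda(-1)^{\lambda+j}\frac{j!\,S(\lambda,j)}{s+k-j-1}$$ and $$\Gamma(s)\zeta(s-\lambda)=\sum_{k=0}^\infty\alpha_k(s)\sum_{j=0}^{\lambda-1}E(\lambda,j)\,\frac{(\lambda-j-1)!}{\prod_{i=j+2}^{\lambda+1}(s+k-i)},$$ where $S(\lambda,j)$ and $E(\lambda,j)$ denote respectively the Stirling numbers of the second kind and the Eulerian numbers. (iv) For all $s\in\mathbb{C}\setminus\{0,-1,-2,\ldots\}$, $$\Gamma(s)\zeta(s+1)=\sum_{k=0}^\infty\alpha_k(s)\,\Psi_1(s+k)=\sum_{k=0}^\infty\sum_{n=0}^\infty\frac{\alpha_k(s)}{(s+k+n)^2},$$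 where $\Psi_1$ is the trigamma function.
   Context: For $|t|<1$ let $g(t)=\frac{-\log(1-t)}{t}=\sum_{k=0}^\infty \frac{t^k}{k+1}$ (so $g(0)=1$), which is analytic and non-vanishing on $|t|<1$. For $s\in\mathbb{C}$, $g(t)^{s-1}=\exp((s-1)\log g(t))$ with the branch of $\log g$ that is analytic on $|t|<1$ with $\log g(0)=0$; the $\alpha_k(s)$ are its Taylor coefficients at $t=0$. $\Gamma$ and $\zeta$ denote the (meromorphically continued) Gamma and Riemann zeta functions. The trigamma function is $\Psi_1(z)=\frac{d^2}{dz^2}\log\Gamma(z)=\sum_{n=0}^\infty (z+n)^{-2}$. The Stirling numbers of the second kind are defined by $x^\lambda=\sum_{j=1}^\lambda S(\lambda,j)\,x(x-1)\cdots(x-j+1)$ for $\lambda\ge1$. The Eulerian numbers $E(\lambda,j)$ are defined by $E(1,0)=1$, $E(\lambda,j)=0$ for $j<0$ or $j\ge\lambda$, and $E(\lambda+1,j)=(j+1)E(\lambda,j)+(\lambda+1-j)E(\lambda,j-1)$ for $\lambda\ge 1$. The double sum in (iv) is an iterated sum, summing over $n$ first. *)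

theory Defs
  imports "HOL-Complex_Analysis.Complex_Analysis" "HOL-Combinatorics.Stirling"
begin

definition log_quot :: "complex \<Rightarrow> complex" where
  "log_quot t = (if t = 0 then 1 else - Ln (1 - t) / t)"

(* The branch of log (log_quot t) that is analytic on |t| < 1 and vanishes at 0.  It is unique
   on the disc; its values elsewhere are unspecified and never used. *)
definition log_branch :: "complex \<Rightarrow> complex" where
  "log_branch = (SOME L. L holomorphic_on ball 0 1 \<and> L 0 = 0 \<and>
                   (\<forall>t\<in>ball 0 1. exp (L t) = log_quot t))"

definition log_quot_power :: "complex \<Rightarrow> complex \<Rightarrow> complex" where
  "log_quot_power s t = exp ((s - 1) * log_branch t)"

definition alpha :: "nat \<Rightarrow> complex \<Rightarrow> complex" where
  "alpha k s = (deriv ^^ k) (log_quot_power s) 0 / fact k"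

(* Analytic continuation of the Dirichlet series; unique on the connected set -{1}.
   The value at the pole 1 is unspecified. *)
definition zeta :: "complex \<Rightarrow> complex" where
  "zeta = (SOME f. f holomorphic_on - {1} \<and>
             (\<forall>s. Re s > 1 \<longrightarrow> (\<lambda>n. of_nat (Suc n) powr (- s)) sums f s))"

(* Only n >= 1 is meaningful; the row n = 0 is set to zero.  The first summand vanishes for
   j = n + 1 by E(n,n) = 0, and the truncated subtraction only matters for j > n + 1, where
   both summands vanish (see eulerian_eq_0). *)
fun eulerian :: "nat \<Rightarrow> nat \<Rightarrow> nat" where
  "eulerian 0 j = 0"
| "eulerian (Suc 0) j = (if j = 0 then 1 else 0)"
| "eulerian (Suc (Suc n)) j =
     (j + 1) * eulerian (Suc n) j +
     (if j = 0 then 0 else (Suc n + 1 - j) * eulerian (Suc n) (j - 1))"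

lemma eulerian_eq_0: "n \<le> j \<Longrightarrow> eulerian n j = 0"
  by (induction n j rule: eulerian.induct) auto

lemma eulerian_rec:
  assumes "n \<ge> 1"
  shows "int (eulerian (n + 1) j) =
           (int j + 1) * int (eulerian n j) +
           (int n + 1 - int j) * (if j = 0 then 0 else int (eulerian n (j - 1)))"
proof -
  obtain m where n: "n = Suc m"
    using assms by (cases n) auto
  show ?thesis
  proof (cases "j \<le> n + 1")
    case True
    then have "int (Suc m + 1 - j) = int n + 1 - int j"
      by (simp add: n)
    then show ?thesis
      by (simp add: n distrib_right del: of_nat_diff Suc_diff_le)
  next
    case False
    then show ?thesis by (auto simp: eulerian_eq_0)
  qed
qed

lemma power_eq_sum_Stirling:
  fixes x :: "'a :: comm_ring_1"
  assumes "n \<ge> 1"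
  shows "x ^ n = (\<Sum>j=1..n. of_nat (Stirling n j) * (\<Prod>i<j. x - of_nat i))"
proof -
  define p where "p j = (\<Prod>i<j. x - of_nat i)" for j
  have p_Suc: "x * p j = p (Suc j) + of_nat j * p j" for j
    by (simp add: p_def algebra_simps)
  have *: "x ^ n = (\<Sum>j\<le>n. of_nat (Stirling n j) * p j)" for n
  proof (induction n)
    case 0
    show ?case by (simp add: p_def)
  next
    case (Suc n)
    have "x ^ Suc n = (\<Sum>j\<le>n. of_nat (Stirling n j) * (x * p j))"
      by (simp add: Suc.IH sum_distrib_left mult_ac)
    also have "\<dots> = (\<Sum>j\<le>n. of_nat (Stirling n j) * p (Suc j)) +
                    (\<Sum>j\<le>n. of_nat (j * Stirling n j) * p j)"
      by (simp add: p_Suc algebra_simps sum.distrib)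
    also have "(\<Sum>j\<le>n. of_nat (j * Stirling n j) * p j) =
               (\<Sum>j\<le>Suc n. of_nat (j * Stirling n j) * p j)"
      by simp
    also have "\<dots> = (\<Sum>j\<le>n. of_nat (Suc j * Stirling n (Suc j)) * p (Suc j))"
      by (subst sum.atMost_Suc_shift) simp
    finally have "x ^ Suc n = (\<Sum>j\<le>n. of_nat (Stirling (Suc n) (Suc j)) * p (Suc j))"
      by (simp add: sum.distrib [symmetric] algebra_simps)
    also have "\<dots> = (\<Sum>j\<le>Suc n. of_nat (Stirling (Suc n) j) * p j)"
      by (subst sum.atMost_Suc_shift) simp
    finally show ?case .
  qed
  have "Stirling n 0 = 0"
    using assms by (cases n) auto
  then have "(\<Sum>j\<le>n. of_nat (Stirling n j) * p j) = (\<Sum>j=1..n. of_nat (Stirling n j) * p j)"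
    by (intro sum.mono_neutral_right) (auto simp: not_less_eq_eq)
  then show ?thesis
    by (simp add: * [of n] p_def)
qed

lemma log_quot_holomorphic: "log_quot holomorphic_on ball 0 1"
proof (rule pole_theorem_0)
  have re: "1 - t \<notin> \<real>\<^sub>\<le>\<^sub>0" if "t \<in> ball 0 1" for t :: complex
  proof -
    have "Re t \<le> norm t"
      by (rule complex_Re_le_cmod)
    with that have "0 < Re (1 - t)"
      by simp
    then show ?thesis
      by (auto simp: complex_nonpos_Reals_iff)
  qed
  show "(\<lambda>t. - Ln (1 - t)) holomorphic_on ball 0 1"
    by (intro holomorphic_intros re)
  have "((\<lambda>t. - Ln (1 - t)) has_field_derivative 1) (at 0)"
    by (auto intro!: derivative_eq_intros)
  then show "log_quot 0 = deriv (\<lambda>t. - Ln (1 - t)) 0"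
    by (simp add: DERIV_imp_deriv log_quot_def)
qed (auto simp: log_quot_def)

lemma log_quot_nonzero:
  assumes "t \<in> ball 0 1"
  shows "log_quot t \<noteq> 0"
proof
  assume "log_quot t = 0"
  then have "t \<noteq> 0" "Ln (1 - t) = 0"
    by (auto simp: log_quot_def split: if_splits)
  moreover have "1 - t \<noteq> 0"
    using assms by auto
  ultimately have "1 - t = 1"
    by (metis exp_Ln exp_zero)
  with \<open>t \<noteq> 0\<close> show False
    by simp
qed

lemma log_branch:
  shows "log_branch holomorphic_on ball 0 1"
    and "log_branch 0 = 0"
    and "t \<in> ball 0 1 \<Longrightarrow> exp (log_branch t) = log_quot t"
proof -
  obtain L where L: "L holomorphic_on ball 0 1" "\<And>t. t \<in> ball 0 1 \<Longrightarrow> exp (L t) = log_quot t"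
    using holomorphic_logarithm_exists [OF _ _ log_quot_holomorphic log_quot_nonzero, of 0]
    by auto
  have "exp (L 0) = 1"
    using L(2) [of 0] by (simp add: log_quot_def)
  then have "(\<lambda>t. L t - L 0) holomorphic_on ball 0 1 \<and> L 0 - L 0 = 0 \<and>
             (\<forall>t\<in>ball 0 1. exp (L t - L 0) = log_quot t)"
    using L by (auto simp: exp_diff intro!: holomorphic_intros)
  then have "\<exists>L. L holomorphic_on ball 0 1 \<and> L 0 = 0 \<and>
               (\<forall>t\<in>ball 0 1. exp (L t) = log_quot t)"
    by (rule exI [of _ "\<lambda>t. L t - L 0"])
  from someI_ex [OF this]
  show "log_branch holomorphic_on ball 0 1" "log_branch 0 = 0"
    and "t \<in> ball 0 1 \<Longrightarrow> exp (log_branch t) = log_quot t"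
    unfolding log_branch_def by blast+
qed

lemma alpha_sums:
  assumes "norm t < 1"
  shows "(\<lambda>k. alpha k s * t ^ k) sums log_quot_power s t"
proof -
  have "log_quot_power s holomorphic_on ball 0 1"
    unfolding log_quot_power_def [abs_def] by (intro holomorphic_intros log_branch)
  from holomorphic_power_series [OF this, of t] assms show ?thesis
    by (simp add: alpha_def)
qed

end

theory Submission
  imports Defs
begin

text \<open>
  Substituting \<open>t = 1 - exp (-u)\<close> in Euler's integral gives, for every weight
  \<open>w t = (\<Sum>m. b m * (1 - t) ^ m)\<close>,
  \<open>\<integral>\<^sub>0\<^sup>1 (- ln (1 - t)) powr (s - 1) * w t dt = \<Gamma>(s) * (\<Sum>m. b m / (m + 1) powr s)\<close>.
  On the other hand \<open>(- ln (1 - t)) powr (s - 1) = t powr (s - 1) * (\<Sum>k. \<alpha> k s * t ^ k)\<close>, so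
  termwise integration turns the same integral into
  \<open>\<Sum>k. \<alpha> k s * \<integral>\<^sub>0\<^sup>1 t powr (s + k - 1) * w t dt\<close>; equating the two is
  \<open>alpha_series_of_weight\<close>. The weight \<open>1\<close> has \<open>b m = 0\<close> for \<open>m > 0\<close> and yields
  \<open>\<Gamma>(s)\<close>; the weight \<open>1 / t ^ (j + 1)\<close> has \<open>b m = (m + j choose j)\<close> and yields, for \<open>j = 0\<close>,
  \<open>\<Gamma>(s) \<zeta>(s)\<close> and, combined over \<open>j\<close> with Stirling numbers, \<open>\<Gamma>(s) \<zeta>(s - \<lambda>)\<close>; the weight
  \<open>- ln t / (1 - t)\<close> has \<open>b m = 1 / (m + 1)\<close> and yields \<open>\<Gamma>(s) \<zeta>(s + 1)\<close>.

  Both interchanges of sum and integral, and all convergence questions, rest on one positivity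
  fact. Write \<open>g\<close> for \<open>log_quot\<close>. Its Taylor coefficients \<open>1 / (n + 1)\<close> are logarithmically
  convex, so by Kaluza's theorem the logarithmic derivative \<open>g' / g\<close> has nonnegative
  coefficients. They are the coefficients of the recurrence \<open>alpha_Suc\<close> for \<open>\<alpha> k s\<close>, which makes
  \<open>\<alpha> k s\<close> nonnegative for real \<open>s \<ge> 1\<close>, so that monotone convergence justifies the
  interchanges there, and which gives the majorant
  \<open>\<bar>\<alpha> k s\<bar> \<le> \<alpha> k (1 + r)\<close> for \<open>\<bar>s - 1\<bar> \<le> r\<close>. Since
  \<open>\<Sum>k. \<alpha> k (1 + r) / (1 + r + k) = \<Gamma>(1 + r)\<close> is finite, every series
  \<open>\<Sum>k. \<alpha> k s * R k s\<close> with \<open>R k s = O(1 / k)\<close> locally uniformly in \<open>s\<close> converges locally uniformly.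
  Its sum is holomorphic, and the identity theorem carries the formulas from a real ray to the
  whole domain (\<open>alpha_series_continuation\<close>).

  The continuation of the zeta function comes from the same source: dividing the series for
  \<open>\<Gamma>(s) \<zeta>(s)\<close> termwise by \<open>\<Gamma>(s)\<close> removes every pole except the one at \<open>1\<close>
  (\<open>zeta_exists\<close>). Finally, the Stirling and the Eulerian form of the coefficients agree as
  rational functions, because both are \<open>1 / (z - 2)\<close> for \<open>\<lambda> = 1\<close> and satisfy
  \<open>P (\<lambda> + 1) z = (z - 1) * (P \<lambda> (z - 1) - P \<lambda> z)\<close>.
\<close>

section \<open>Positivity of the Taylor coefficients\<close>

text \<open>
  Kaluza's theorem. Comparing coefficients in \<open>A * inverse A = 1\<close> at the indices \<open>k\<close> and
  \<open>k + 1\<close> and eliminating the constant term of the inverse expresses its next coefficient as a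
  sum of earlier ones, each multiplied by a difference that \<open>ratio\<close> makes nonnegative.
\<close>
lemma kaluza_inverse_coeff_nonpos:
  fixes a :: "nat \<Rightarrow> real"
  assumes pos: "\<And>n. a n > 0"
    and ratio: "\<And>m n. m \<le> n \<Longrightarrow> a (Suc m) * a n \<le> a (Suc n) * a m"
    and "n > 0"
  shows "fps_nth (inverse (Abs_fps a)) n \<le> 0"
  using \<open>n > 0\<close>
proof (induction n rule: less_induct)
  case (less n)
  define b where "b = fps_nth (inverse (Abs_fps a))"
  have inv: "inverse (Abs_fps a) * Abs_fps a = 1"
    using pos[of 0] by (intro inverse_mult_eq_1) auto
  have conv0: "(\<Sum>i=0..k. b i * a (k - i)) = 0" if "k > 0" for k
    using arg_cong[OF inv, of "\<lambda>f. fps_nth f k"] that by (simp add: fps_mult_nth b_def)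
  have b0: "b 0 > 0"
    using pos[of 0] by (simp add: b_def)
  obtain k where k: "n = Suc k"
    using less.prems by (cases n) auto
  have step: "b (Suc k) * a 0 = - (\<Sum>i=0..k. b i * a (Suc k - i))"
    using conv0[of "Suc k"] by simp
  have "b (Suc k) * a 0 \<le> 0"
  proof (cases "k = 0")
    case True
    then show ?thesis using step b0 pos[of 1] by simp
  next
    case False
    \<comment> \<open>The first sum vanishes; including it makes the terms with \<open>i = 0\<close> cancel.\<close>
    have "b (Suc k) * a 0 * a k =
            a (Suc k) * (\<Sum>i=0..k. b i * a (k - i)) - a k * (\<Sum>i=0..k. b i * a (Suc k - i))"
      using conv0[of k] False by (simp add: step)
    also have "\<dots> = (\<Sum>i=0..k. b i * (a (Suc k) * a (k - i) - a (Suc (k - i)) * a k))"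
      unfolding sum_distrib_left sum_subtractf[symmetric]
      by (intro sum.cong refl) (simp add: algebra_simps Suc_diff_le)
    also have "\<dots> \<le> 0"
    proof (rule sum_nonpos)
      fix i assume i: "i \<in> {0..k}"
      show "b i * (a (Suc k) * a (k - i) - a (Suc (k - i)) * a k) \<le> 0"
      proof (cases "i = 0")
        case False
        then have "b i \<le> 0"
          using less.IH[of i] i k by (simp add: b_def)
        moreover have "a (Suc k) * a (k - i) - a (Suc (k - i)) * a k \<ge> 0"
          using ratio[of "k - i" k] by simp
        ultimately show ?thesis by (rule mult_nonpos_nonneg)
      qed simp
    qed
    finally show ?thesis
      using pos[of k] by (simp add: mult_le_0_iff)
  qed
  then show ?case
    using pos[of 0] by (simp add: k b_def mult_le_0_iff)
qed

definition log_quot_fps :: "real fps" where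
  "log_quot_fps = Abs_fps (\<lambda>n. 1 / real (Suc n))"

definition log_deriv_coeff :: "nat \<Rightarrow> real" where
  "log_deriv_coeff = fps_nth (fps_deriv log_quot_fps * inverse log_quot_fps)"

text \<open>
  With \<open>B = inverse A\<close> the identity \<open>A' * B = - B' * A\<close> moves the derivative to the series \<open>B\<close>,
  whose coefficients beyond the constant one are nonpositive by Kaluza's theorem.
\<close>
lemma log_deriv_coeff_nonneg: "log_deriv_coeff n \<ge> 0"
proof -
  have nonpos: "fps_nth (inverse log_quot_fps) n \<le> 0" if "n > 0" for n
    unfolding log_quot_fps_def
  proof (rule kaluza_inverse_coeff_nonpos[OF _ _ that])
    fix m n :: nat
    assume "m \<le> n"
    then show "1 / real (Suc (Suc m)) * (1 / real (Suc n)) \<le> 1 / real (Suc (Suc n)) * (1 / real (Suc m))"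
      unfolding times_divide_times_eq mult_1 by (intro divide_left_mono mult_pos_pos) (auto simp: algebra_simps)
  qed simp
  have "fps_deriv log_quot_fps * inverse log_quot_fps = - fps_deriv (inverse log_quot_fps) * log_quot_fps"
  proof -
    have nz: "fps_nth log_quot_fps 0 \<noteq> 0" by (simp add: log_quot_fps_def)
    then show ?thesis
      using inverse_mult_eq_1[of log_quot_fps] by (simp add: fps_inverse_deriv power2_eq_square mult.assoc)
  qed
  then have "log_deriv_coeff n = (\<Sum>i=0..n. - (real (Suc i) * fps_nth (inverse log_quot_fps) (Suc i)) / real (Suc (n - i)))"
    by (simp add: log_deriv_coeff_def fps_mult_nth log_quot_fps_def sum_negf del: of_nat_Suc)
  also have "\<dots> \<ge> 0"
    by (intro sum_nonneg divide_nonneg_nonneg) (auto simp: mult_le_0_iff nonpos)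
  finally show ?thesis .
qed

lemma alpha_0 [simp]: "alpha 0 s = 1"
  by (simp add: alpha_def log_quot_power_def log_branch)

lemma log_quot_power_has_fps_expansion:
  "log_quot_power s has_fps_expansion Abs_fps (\<lambda>k. alpha k s)"
proof (rule has_fps_expansionI)
  have "eventually (\<lambda>t::complex. t \<in> ball 0 1) (nhds 0)"
    by (intro eventually_nhds_in_open) auto
  then show "eventually (\<lambda>t. (\<lambda>k. fps_nth (Abs_fps (\<lambda>k. alpha k s)) k * t ^ k) sums log_quot_power s t) (nhds 0)"
    by eventually_elim (use alpha_sums in auto)
qed

lemma log_branch_has_fps_expansion: "log_branch has_fps_expansion fps_expansion log_branch 0"
  by (intro analytic_at_imp_has_fps_expansion_0) (use log_branch(1) in \<open>auto simp: analytic_at intro!: exI[of _ "ball 0 1"]\<close>)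

lemma log_quot_has_fps_expansion:
  "log_quot has_fps_expansion Abs_fps (\<lambda>n. of_real (fps_nth log_quot_fps n))"
proof (rule has_fps_expansionI)
  have "eventually (\<lambda>t::complex. t \<in> ball 0 1) (nhds 0)"
    by (intro eventually_nhds_in_open) auto
  then show "eventually (\<lambda>t. (\<lambda>k. fps_nth (Abs_fps (\<lambda>n. of_real (fps_nth log_quot_fps n))) k * t ^ k) sums log_quot t) (nhds 0)"
  proof eventually_elim
    case (elim t)
    show ?case
    proof (cases "t = 0")
      case True
      then show ?thesis 
        using powser_sums_zero[of "\<lambda>n. of_real (fps_nth log_quot_fps n) :: complex"]
        by (simp add: log_quot_def log_quot_fps_def)
    next
      case False
      have "(\<lambda>n. - (t ^ n / of_nat n)) sums Ln (1 - t)"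
        using Ln_series'[of "-t"] elim by simp
      then have "(\<lambda>n. t ^ n / of_nat n) sums (- Ln (1 - t))"
        using sums_minus by fastforce
      then have "(\<lambda>n. t ^ Suc n / of_nat (Suc n)) sums (- Ln (1 - t))"
        by (subst sums_Suc_iff) simp
      then have "(\<lambda>n. t ^ Suc n / of_nat (Suc n) / t) sums (- Ln (1 - t) / t)"
        by (rule sums_divide)
      then show ?thesis
        using False by (simp add: log_quot_def log_quot_fps_def)
    qed
  qed
qed

lemma fps_deriv_log_quot_power:
  "fps_deriv (Abs_fps (\<lambda>k. alpha k s)) =
     fps_const (s - 1) * fps_deriv (fps_expansion log_branch 0) * Abs_fps (\<lambda>k. alpha k s)"
proof (rule fps_expansion_unique_complex)
  show "deriv (log_quot_power s) has_fps_expansion fps_deriv (Abs_fps (\<lambda>k. alpha k s))"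
    by (intro has_fps_expansion_deriv log_quot_power_has_fps_expansion)
  have "eventually (\<lambda>t::complex. t \<in> ball 0 1) (nhds 0)"
    by (intro eventually_nhds_in_open) auto
  then have "eventually (\<lambda>t. (s - 1) * deriv log_branch t * log_quot_power s t = deriv (log_quot_power s) t) (nhds 0)"
  proof eventually_elim
    case (elim t)
    then have [derivative_intros]: "(log_branch has_field_derivative deriv log_branch t) (at t)"
      using log_branch(1) holomorphic_derivI[of log_branch "ball 0 1" t] by simp
    have "(log_quot_power s has_field_derivative (s - 1) * deriv log_branch t * log_quot_power s t) (at t)"
      unfolding log_quot_power_def[abs_def] by (auto intro!: derivative_eq_intros)
    then show ?case by (simp add: DERIV_imp_deriv)
  qed
  moreover have "(\<lambda>t. (s - 1) * deriv log_branch t * log_quot_power s t) has_fps_expansion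
     fps_const (s - 1) * fps_deriv (fps_expansion log_branch 0) * Abs_fps (\<lambda>k. alpha k s)"
    by (intro fps_expansion_intros log_branch_has_fps_expansion log_quot_power_has_fps_expansion)
  ultimately show "deriv (log_quot_power s) has_fps_expansion
     fps_const (s - 1) * fps_deriv (fps_expansion log_branch 0) * Abs_fps (\<lambda>k. alpha k s)"
    by (subst (asm) has_fps_expansion_cong[OF _ refl])
qed

text \<open>
  At \<open>s = 2\<close> the differential equation for \<open>g powr (s - 1)\<close> is \<open>g' = (log g)' * g\<close>, and the real
  series satisfies the same equation, so cancelling \<open>g\<close> identifies \<open>(log g)'\<close>.
\<close>
lemma fps_deriv_log_branch:
  "fps_deriv (fps_expansion log_branch 0) = Abs_fps (\<lambda>n. of_real (log_deriv_coeff n))"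
proof -
  define G :: "complex fps" where "G = Abs_fps (\<lambda>n. of_real (fps_nth log_quot_fps n))"
  have "eventually (\<lambda>t::complex. t \<in> ball 0 1) (nhds 0)"
    by (intro eventually_nhds_in_open) auto
  then have "eventually (\<lambda>t. log_quot_power 2 t = log_quot t) (nhds 0)"
    by eventually_elim (simp add: log_quot_power_def log_branch(3))
  then have "log_quot has_fps_expansion Abs_fps (\<lambda>k. alpha k 2)"
    using has_fps_expansion_cong log_quot_power_has_fps_expansion by blast
  then have "Abs_fps (\<lambda>k. alpha k 2) = G"
    unfolding G_def using fps_expansion_unique_complex log_quot_has_fps_expansion by blast
  then have 1: "fps_deriv G = fps_deriv (fps_expansion log_branch 0) * G"
    using fps_deriv_log_quot_power[of 2] by simp
  have nz: "fps_nth log_quot_fps 0 \<noteq> 0" by (simp add: log_quot_fps_def)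
  have "fps_deriv log_quot_fps = fps_deriv log_quot_fps * inverse log_quot_fps * log_quot_fps"
    using inverse_mult_eq_1[OF nz] by (simp add: mult.assoc)
  then have real: "fps_nth (fps_deriv log_quot_fps) n = (\<Sum>i=0..n. log_deriv_coeff i * fps_nth log_quot_fps (n - i))" for n
    by (metis fps_mult_nth log_deriv_coeff_def)
  have "fps_deriv G = Abs_fps (\<lambda>n. of_real (log_deriv_coeff n)) * G"
  proof (rule fps_ext)
    fix n
    have "fps_nth (fps_deriv G) n = of_real (fps_nth (fps_deriv log_quot_fps) n)"
      by (simp add: G_def)
    also have "\<dots> = fps_nth (Abs_fps (\<lambda>n. of_real (log_deriv_coeff n)) * G) n"
      unfolding real by (simp add: G_def fps_mult_nth)
    finally show "fps_nth (fps_deriv G) n = fps_nth (Abs_fps (\<lambda>n. of_real (log_deriv_coeff n)) * G) n" .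
  qed
  with 1 have "fps_deriv (fps_expansion log_branch 0) * G = Abs_fps (\<lambda>n. of_real (log_deriv_coeff n)) * G"
    by (simp only:)
  moreover have "G \<noteq> 0"
    using nz by (auto simp: G_def fps_eq_iff)
  ultimately show ?thesis by simp
qed

text \<open>
  Coefficient comparison in \<open>(g powr (s - 1))' = (s - 1) * (log g)' * g powr (s - 1)\<close>.
\<close>
lemma alpha_Suc:
  "of_nat (Suc k) * alpha (Suc k) s =
     (s - 1) * (\<Sum>i\<le>k. of_real (log_deriv_coeff i) * alpha (k - i) s)"
proof -
  have "of_nat (Suc k) * alpha (Suc k) s = fps_nth (fps_deriv (Abs_fps (\<lambda>k. alpha k s))) k"
    by simp
  also have "\<dots> = fps_nth (fps_const (s - 1) * (Abs_fps (\<lambda>n. of_real (log_deriv_coeff n)) * Abs_fps (\<lambda>k. alpha k s))) k"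
    by (simp only: fps_deriv_log_quot_power fps_deriv_log_branch mult.assoc)
  also have "\<dots> = (s - 1) * (\<Sum>i\<le>k. of_real (log_deriv_coeff i) * alpha (k - i) s)"
    unfolding fps_mult_left_const_nth by (simp add: fps_mult_nth atLeast0AtMost)
  finally show ?thesis .
qed

lemma alpha_holomorphic: "alpha k holomorphic_on A"
proof (induction k rule: less_induct)
  case (less k)
  show ?case
  proof (cases k)
    case 0
    then show ?thesis by (simp add: alpha_0[abs_def])
  next
    case (Suc m)
    have "alpha k = (\<lambda>s. (s - 1) * (\<Sum>i\<le>m. of_real (log_deriv_coeff i) * alpha (m - i) s) / of_nat (Suc m))"
      using alpha_Suc[of m] by (simp add: Suc fun_eq_iff field_simps del: of_nat_Suc)
    moreover have "\<dots> holomorphic_on A"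
      by (intro holomorphic_intros less.IH) (auto simp: Suc simp del: of_nat_Suc)
    ultimately show ?thesis by simp
  qed
qed

lemma alpha_real_nonneg:
  assumes "s \<ge> 1"
  shows "\<exists>a\<ge>0. alpha k (of_real s) = of_real a"
proof (induction k rule: less_induct)
  case (less k)
  show ?case
  proof (cases k)
    case 0
    then show ?thesis by (intro exI[of _ 1]) simp
  next
    case (Suc m)
    have "\<forall>i. \<exists>a. i \<le> m \<longrightarrow> a \<ge> 0 \<and> alpha i (of_real s) = of_real a"
      using less.IH Suc by (metis le_imp_less_Suc)
    then obtain a where a: "\<And>i. i \<le> m \<Longrightarrow> a i \<ge> 0 \<and> alpha i (of_real s) = of_real (a i)"
      by metis
    have "alpha k (of_real s) = (s - 1) * (\<Sum>i\<le>m. of_real (log_deriv_coeff i) * alpha (m - i) s) / of_nat (Suc m)"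
      using alpha_Suc[of m s] by (simp add: Suc field_simps del: of_nat_Suc)
    also have "\<dots> = of_real ((s - 1) * (\<Sum>i\<le>m. log_deriv_coeff i * a (m - i)) / of_nat (Suc m))"
      using a by (simp del: of_nat_Suc)
    finally show ?thesis
      using a assms log_deriv_coeff_nonneg
      by (intro exI[of _ "(s - 1) * (\<Sum>i\<le>m. log_deriv_coeff i * a (m - i)) / of_nat (Suc m)"])
         (auto intro!: divide_nonneg_nonneg mult_nonneg_nonneg sum_nonneg simp del: of_nat_Suc)
  qed
qed

lemma
  assumes "s \<ge> 1"
  shows Re_alpha_nonneg: "Re (alpha k (of_real s)) \<ge> 0"
    and alpha_of_real: "alpha k (of_real s) = of_real (Re (alpha k (of_real s)))"
  using alpha_real_nonneg[OF assms, of k] by auto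

text \<open>
  The recurrence \<open>alpha_Suc\<close> has nonnegative weights, so enlarging \<open>\<bar>s - 1\<bar>\<close> to \<open>r\<close> and each
  earlier coefficient to its majorant reproduces the recurrence at the real point \<open>1 + r\<close>.
\<close>
lemma norm_alpha_le:
  assumes "norm (s - 1) \<le> r"
  shows "norm (alpha k s) \<le> Re (alpha k (of_real (1 + r)))"
proof (induction k rule: less_induct)
  case (less k)
  have r: "1 \<le> 1 + r"
    using assms norm_ge_zero[of "s - 1"] by linarith
  let ?b = "\<lambda>k. Re (alpha k (of_real (1 + r)))"
  show ?case
  proof (cases k)
    case (Suc m)
    have "real (Suc m) * norm (alpha k s) = norm (of_nat (Suc m) * alpha (Suc m) s)"
      by (simp only: norm_mult norm_of_nat Suc)
    also have "\<dots> = norm (s - 1) * norm (\<Sum>i\<le>m. of_real (log_deriv_coeff i) * alpha (m - i) s)"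
      by (simp only: alpha_Suc norm_mult)
    also have "\<dots> \<le> r * (\<Sum>i\<le>m. log_deriv_coeff i * ?b (m - i))"
    proof (intro mult_mono assms sum_norm_le)
      fix i
      show "norm (of_real (log_deriv_coeff i) * alpha (m - i) s) \<le> log_deriv_coeff i * ?b (m - i)"
        using less.IH[of "m - i"] log_deriv_coeff_nonneg[of i]
        by (auto simp: norm_mult Suc intro!: mult_left_mono)
    qed (use r in auto)
    also have "\<dots> = Re (of_nat (Suc m) * alpha (Suc m) (of_real (1 + r)))"
    proof -
      have "of_nat (Suc m) * alpha (Suc m) (of_real (1 + r)) =
              of_real r * (\<Sum>i\<le>m. of_real (log_deriv_coeff i) * of_real (?b (m - i)))"
        unfolding alpha_Suc by (subst alpha_of_real[OF r]) simp
      also have "\<dots> = of_real (r * (\<Sum>i\<le>m. log_deriv_coeff i * ?b (m - i)))"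
        by simp
      finally show ?thesis by (simp only: Re_complex_of_real)
    qed
    also have "\<dots> = real (Suc m) * ?b k"
      by (simp add: Suc del: of_nat_Suc)
    finally show ?thesis by (simp del: of_nat_Suc)
  qed simp
qed

text \<open>
  On the real interval the chosen branch of \<open>log g\<close> is the real logarithm, because its Taylor
  coefficients are real; hence the complex power is a real one.
\<close>
lemma alpha_sums_real:
  assumes s: "s \<ge> 1" and t: "0 < t" "t < 1"
  shows "(\<lambda>k. Re (alpha k (of_real s)) * t ^ k) sums ((- ln (1 - t) / t) powr (s - 1))"
proof -
  define L where "L = fps_expansion log_branch 0"
  define q where "q = - ln (1 - t) / t"
  have q: "q > 0" using t by (auto simp: q_def intro!: divide_neg_pos)
  have L0: "fps_nth L 0 = 0" by (simp add: L_def fps_expansion_def log_branch)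
  have Lreal: "fps_nth L n \<in> \<real>" for n
  proof (cases n)
    case (Suc m)
    have "of_nat (Suc m) * fps_nth L (Suc m) = fps_nth (fps_deriv L) m" by simp
    also have "\<dots> = of_real (log_deriv_coeff m)" by (simp only: L_def fps_deriv_log_branch fps_nth_Abs_fps)
    finally have "fps_nth L n = of_real (log_deriv_coeff m / real (Suc m))"
      by (simp add: Suc field_simps del: of_nat_Suc)
    then show ?thesis by (simp only: Reals_of_real)
  qed (simp add: L0)
  have "(\<lambda>n. fps_nth L n * of_real t ^ n) sums log_branch (of_real t)"
    using holomorphic_power_series[OF log_branch(1), of "of_real t"] t
    by (simp add: L_def fps_expansion_def)
  then have "(\<lambda>n. Im (fps_nth L n * of_real t ^ n)) sums Im (log_branch (of_real t))"
    by (rule sums_Im)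
  moreover have "Im (fps_nth L n * of_real t ^ n) = 0" for n
    using Lreal[of n] by (simp add: complex_is_Real_iff flip: of_real_power)
  ultimately have "(\<lambda>n. 0) sums Im (log_branch (of_real t))"
    by (simp only:)
  then have "Im (log_branch (of_real t)) = 0"
    by (simp add: sums_iff)
  then obtain x where x: "log_branch (of_real t) = of_real x"
    using complex_is_Real_iff Reals_cases by metis
  have "of_real (exp x) = exp (log_branch (of_real t))" by (simp add: x exp_of_real)
  also have "\<dots> = log_quot (of_real t)" using t by (intro log_branch(3)) auto
  also have "\<dots> = of_real q"
    using t Ln_of_real[of "1 - t"] by (simp add: log_quot_def q_def)
  finally have "exp x = q" by (simp only: of_real_eq_iff)
  then have "log_quot_power (of_real s) (of_real t) = of_real (q powr (s - 1))"
    using q by (auto simp: log_quot_power_def x powr_def mult_ac exp_of_real[symmetric])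
  then have "(\<lambda>k. alpha k (of_real s) * of_real t ^ k) sums of_real (q powr (s - 1))"
    using alpha_sums[of "of_real t" "of_real s"] t by simp
  then have "(\<lambda>k. Re (alpha k (of_real s) * of_real t ^ k)) sums (q powr (s - 1))"
    using sums_Re by fastforce
  then show ?thesis
    by (simp add: q_def flip: of_real_power)
qed

section \<open>Integrals over the unit interval\<close>

lemma nn_integral_Gamma_scaled:
  fixes s c :: real
  assumes "s > 0" "c > 0"
  shows "(\<integral>\<^sup>+u. ennreal (u powr (s - 1) * exp (- c * u)) * indicator {0<..} u \<partial>lborel) = ennreal (Gamma s / c powr s)"
proof -
  define f where "f = (\<lambda>u::real. ennreal (u powr (s - 1) * exp (- u)) * indicator {0<..} u)"
  have [measurable]: "f \<in> borel_measurable borel" unfolding f_def by measurable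
  have "ennreal (Gamma s) = (\<integral>\<^sup>+u. ennreal (indicator {0..} u * u powr (s - 1) / exp u) \<partial>lborel)"
    using assms by (simp add: Gamma_conv_nn_integral_real)
  also have "\<dots> = (\<integral>\<^sup>+u. f u \<partial>lborel)"
    by (intro nn_integral_cong) (auto simp: f_def indicator_def exp_minus field_simps)
  also have "\<dots> = ennreal c * (\<integral>\<^sup>+u. f (0 + c * u) \<partial>lborel)"
    using assms by (subst nn_integral_real_affine[of _ c 0]) auto
  also have "(\<integral>\<^sup>+u. f (0 + c * u) \<partial>lborel) =
      (\<integral>\<^sup>+u. ennreal (c powr (s - 1)) * (ennreal (u powr (s - 1) * exp (- c * u)) * indicator {0<..} u) \<partial>lborel)"
    using assms by (intro nn_integral_cong)
      (auto simp: f_def indicator_def powr_mult zero_less_mult_iff mult.assoc ennreal_mult[symmetric])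
  also have "\<dots> = ennreal (c powr (s - 1)) * (\<integral>\<^sup>+u. ennreal (u powr (s - 1) * exp (- c * u)) * indicator {0<..} u \<partial>lborel)"
    by (intro nn_integral_cmult) measurable
  finally have "ennreal (Gamma s) = ennreal (c powr s) * (\<integral>\<^sup>+u. ennreal (u powr (s - 1) * exp (- c * u)) * indicator {0<..} u \<partial>lborel)" (is "_ = _ * ?I")
    using assms by (simp add: mult.assoc[symmetric] ennreal_mult[symmetric] powr_diff)
  then have "ennreal (Gamma s) / ennreal (c powr s) = ?I * ennreal (c powr s) / ennreal (c powr s)"
    by (simp only: mult.commute)
  also have "\<dots> = ?I"
    using assms by (intro mult_divide_eq_ennreal) auto
  finally have "ennreal (Gamma s) / ennreal (c powr s) = ?I" .
  then show ?thesis
    using assms by (simp add: divide_ennreal)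
qed

text \<open>
  Euler's integral for \<open>\<Gamma>(s) / a powr s\<close> under \<open>u = - ln t\<close>.
\<close>
lemma nn_integral_neg_ln_powr:
  fixes s a :: real
  assumes "s > 0" "a > 0"
  shows "(\<integral>\<^sup>+t. ennreal ((- ln t) powr (s - 1) * t powr (a - 1)) * indicator {0<..<1} t \<partial>lborel) = ennreal (Gamma s / a powr s)"
proof -
  define f where "f = (\<lambda>u::real. u powr (s - 1) * exp (- a * u))"
  have [measurable]: "f \<in> borel_measurable borel" unfolding f_def by measurable
  have nonneg: "f u \<ge> 0" for u by (simp add: f_def)
  have "(\<integral>\<^sup>+u. ennreal (f u * indicator {0<..} u) \<partial>lborel) = ennreal (Gamma s / a powr s)"
    using nn_integral_Gamma_scaled[OF assms] by (simp add: f_def ennreal_mult ennreal_indicator)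
  then have "((\<lambda>u. f u * indicator {0<..} u) has_integral (Gamma s / a powr s)) UNIV"
    using assms by (intro nn_integral_has_integral) (auto simp: nonneg)
  then have int: "(f has_integral (Gamma s / a powr s)) {0<..}"
    by (subst has_integral_restrict_UNIV[symmetric]) (simp add: indicator_def of_bool_def if_distrib cong: if_cong)
  have image: "(\<lambda>t::real. - ln t) ` {0<..<1} = {0<..}"
  proof (intro equalityI subsetI)
    fix u :: real assume "u \<in> {0<..}"
    then show "u \<in> (\<lambda>t. - ln t) ` {0<..<1}"
      by (intro image_eqI[of _ _ "exp (- u)"]) auto
  qed auto
  have "(\<lambda>t. \<bar>- 1 / t\<bar> * f (- ln t)) absolutely_integrable_on {0<..<1} \<and>
         integral {0<..<1} (\<lambda>t. \<bar>- 1 / t\<bar> * f (- ln t)) = Gamma s / a powr s"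
  proof (rule has_absolute_integral_change_of_variables_1'[of _ "\<lambda>t. - ln t" "\<lambda>t. - 1 / t", THEN iffD2])
    show "f absolutely_integrable_on (\<lambda>t::real. - ln t) ` {0<..<1} \<and>
          integral ((\<lambda>t::real. - ln t) ` {0<..<1}) f = Gamma s / a powr s"
      unfolding image using int nonneg
      by (auto intro!: nonnegative_absolutely_integrable_1 simp: has_integral_iff)
  qed (auto intro!: derivative_eq_intros simp: inj_on_def)
  then have "((\<lambda>t. \<bar>- 1 / t\<bar> * f (- ln t)) has_integral (Gamma s / a powr s)) {0<..<1}"
    by (auto simp: has_integral_iff absolutely_integrable_on_def)
  also have "?this \<longleftrightarrow> ((\<lambda>t. (- ln t) powr (s - 1) * t powr (a - 1)) has_integral (Gamma s / a powr s)) {0<..<1}"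
    by (intro has_integral_cong) (auto simp: f_def powr_def[of _ "a - 1"] exp_diff algebra_simps)
  finally show ?thesis
    by (intro nn_integral_has_integral_lebesgue') auto
qed

lemma nn_integral_reflect_unit_interval:
  assumes [measurable]: "f \<in> borel_measurable borel"
  shows "(\<integral>\<^sup>+t. f (1 - t) * indicator {0<..<1} t \<partial>lborel) = (\<integral>\<^sup>+t. f t * indicator {0<..<1::real} t \<partial>lborel)"
proof -
  have "(\<integral>\<^sup>+t. f t * indicator {0<..<1} t \<partial>lborel) = (\<integral>\<^sup>+t. f (1 + - 1 * t) * indicator {0<..<1} (1 + - 1 * t) \<partial>lborel)"
    by (subst nn_integral_real_affine[of _ "-1" 1]) auto
  also have "\<dots> = (\<integral>\<^sup>+t. f (1 - t) * indicator {0<..<1} t \<partial>lborel)"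
    by (intro nn_integral_cong) (auto simp: indicator_def)
  finally show ?thesis ..
qed

lemma nn_integral_powr:
  fixes a :: real
  assumes "a > 0"
  shows "(\<integral>\<^sup>+t. ennreal (t powr (a - 1)) * indicator {0<..<1} t \<partial>lborel) = ennreal (1 / a)"
proof -
  have "(\<integral>\<^sup>+t. ennreal (t powr (a - 1)) * indicator {0<..<1} t \<partial>lborel) =
        (\<integral>\<^sup>+t. ennreal ((- ln t) powr (1 - 1) * t powr (a - 1)) * indicator {0<..<1} t \<partial>lborel)"
    by (intro nn_integral_cong) (auto simp: indicator_def)
  also have "\<dots> = ennreal (1 / a)"
    using assms by (subst nn_integral_neg_ln_powr) auto
  finally show ?thesis .
qed

text \<open>
  Both sides are \<open>\<integral>\<^sub>0\<^sup>1 (- ln (1 - t)) powr (s - 1) * w t dt\<close>: the left one by expanding the power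
  in terms of \<open>\<alpha> k s\<close>, the right one by expanding \<open>w\<close> in powers of \<open>1 - t\<close>. All terms are
  nonnegative for \<open>s \<ge> 1\<close>, so sums and integrals may be exchanged in \<open>[0, \<infinity>]\<close>, and finiteness of the
  right-hand side gives convergence of the left-hand series.
\<close>
lemma alpha_series_of_weight:
  fixes b W :: "nat \<Rightarrow> real" and w :: "real \<Rightarrow> real"
  assumes s: "s \<ge> 1"
    and b: "\<And>m. b m \<ge> 0"
    and w: "\<And>t. 0 < t \<Longrightarrow> t < 1 \<Longrightarrow> (\<lambda>m. b m * (1 - t) ^ m) sums w t"
    and [measurable]: "w \<in> borel_measurable borel"
    and W: "\<And>k. (\<integral>\<^sup>+t. ennreal (t powr (s + real k - 1) * w t) * indicator {0<..<1} t \<partial>lborel) = ennreal (W k)"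
    and W_nonneg: "\<And>k. W k \<ge> 0"
    and B: "(\<lambda>m. b m / real (Suc m) powr s) sums B"
  shows "(\<lambda>k. Re (alpha k (of_real s)) * W k) sums (Gamma s * B)"
proof -
  define a where "a = (\<lambda>k. Re (alpha k (of_real s)))"
  have a: "a k \<ge> 0" for k unfolding a_def using s by (rule Re_alpha_nonneg)
  have B_nonneg: "B \<ge> 0"
    using sums_le[OF _ sums_zero B] b by simp
  have w_nonneg: "w t \<ge> 0" if "0 < t" "t < 1" for t
    using sums_le[OF _ sums_zero w[OF that]] b that by simp
  define I where "I = (\<integral>\<^sup>+t. ennreal ((- ln (1 - t)) powr (s - 1) * w t) * indicator {0<..<1} t \<partial>lborel)"
  have "I = (\<integral>\<^sup>+t. (\<Sum>k. ennreal (a k) * (ennreal (t powr (s + real k - 1) * w t) * indicator {0<..<1} t)) \<partial>lborel)"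
    unfolding I_def
  proof (intro nn_integral_cong)
    fix t :: real
    show "ennreal ((- ln (1 - t)) powr (s - 1) * w t) * indicator {0<..<1} t =
          (\<Sum>k. ennreal (a k) * (ennreal (t powr (s + real k - 1) * w t) * indicator {0<..<1} t))"
    proof (cases "t \<in> {0<..<1}")
      case True
      then have t: "0 < t" "t < 1" by auto
      have "(\<lambda>k. a k * t ^ k * (t powr (s - 1) * w t)) sums
              ((- ln (1 - t) / t) powr (s - 1) * (t powr (s - 1) * w t))"
        unfolding a_def by (intro sums_mult2 alpha_sums_real s t)
      moreover have "(- ln (1 - t) / t) powr (s - 1) * (t powr (s - 1) * w t) = (- ln (1 - t)) powr (s - 1) * w t"
      proof -
        have "(- ln (1 - t) / t) powr (s - 1) = (- ln (1 - t)) powr (s - 1) / t powr (s - 1)"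
          by (rule powr_divide)
        then show ?thesis using t by simp
      qed
      moreover have "a k * t ^ k * (t powr (s - 1) * w t) = a k * (t powr (s + real k - 1) * w t)" for k
      proof -
        have "t powr (s + real k - 1) = t ^ k * t powr (s - 1)"
          using t by (simp add: powr_add[symmetric] powr_realpow[symmetric] algebra_simps)
        then show ?thesis by simp
      qed
      ultimately have "(\<lambda>k. a k * (t powr (s + real k - 1) * w t)) sums ((- ln (1 - t)) powr (s - 1) * w t)"
        by (simp only:)
      then have "(\<Sum>k. ennreal (a k * (t powr (s + real k - 1) * w t))) = ennreal ((- ln (1 - t)) powr (s - 1) * w t)"
        using a t w_nonneg by (intro suminf_ennreal_eq) auto
      then show ?thesis
        using a t w_nonneg True by (simp add: ennreal_mult)
    qed simp
  qed
  also have "\<dots> = (\<Sum>k. \<integral>\<^sup>+t. ennreal (a k) * (ennreal (t powr (s + real k - 1) * w t) * indicator {0<..<1} t) \<partial>lborel)"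
    by (intro nn_integral_suminf) measurable
  also have "\<dots> = (\<Sum>k. ennreal (a k * W k))"
    by (subst nn_integral_cmult, measurable) (simp add: W a W_nonneg ennreal_mult)
  finally have 1: "I = (\<Sum>k. ennreal (a k * W k))" .

  have "I = (\<integral>\<^sup>+t. (\<Sum>m. ennreal (b m) * (ennreal ((- ln (1 - t)) powr (s - 1) * (1 - t) powr (real (Suc m) - 1)) * indicator {0<..<1} t)) \<partial>lborel)"
    unfolding I_def
  proof (intro nn_integral_cong)
    fix t :: real
    show "ennreal ((- ln (1 - t)) powr (s - 1) * w t) * indicator {0<..<1} t =
          (\<Sum>m. ennreal (b m) * (ennreal ((- ln (1 - t)) powr (s - 1) * (1 - t) powr (real (Suc m) - 1)) * indicator {0<..<1} t))"
    proof (cases "t \<in> {0<..<1}")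
      case True
      then have t: "0 < t" "t < 1" by auto
      have "(\<lambda>m. (- ln (1 - t)) powr (s - 1) * (b m * (1 - t) ^ m)) sums
              ((- ln (1 - t)) powr (s - 1) * w t)"
        by (intro sums_mult w t)
      moreover have "(- ln (1 - t)) powr (s - 1) * (b m * (1 - t) ^ m) =
          b m * ((- ln (1 - t)) powr (s - 1) * (1 - t) powr (real (Suc m) - 1))" for m
        using t by (simp add: powr_realpow)
      ultimately have "(\<lambda>m. b m * ((- ln (1 - t)) powr (s - 1) * (1 - t) powr (real (Suc m) - 1))) sums
              ((- ln (1 - t)) powr (s - 1) * w t)"
        by simp
      then have "(\<Sum>m. ennreal (b m * ((- ln (1 - t)) powr (s - 1) * (1 - t) powr (real (Suc m) - 1)))) = ennreal ((- ln (1 - t)) powr (s - 1) * w t)"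
        using b by (intro suminf_ennreal_eq) auto
      then show ?thesis
        using b True by (simp add: ennreal_mult)
    qed simp
  qed
  also have "\<dots> = (\<Sum>m. \<integral>\<^sup>+t. ennreal (b m) * (ennreal ((- ln (1 - t)) powr (s - 1) * (1 - t) powr (real (Suc m) - 1)) * indicator {0<..<1} t) \<partial>lborel)"
    by (intro nn_integral_suminf) measurable
  also have "\<dots> = (\<Sum>m. ennreal (b m) * ennreal (Gamma s / real (Suc m) powr s))"
  proof (intro suminf_cong)
    fix m
    have "(\<integral>\<^sup>+t. ennreal (b m) * (ennreal ((- ln (1 - t)) powr (s - 1) * (1 - t) powr (real (Suc m) - 1)) * indicator {0<..<1} t) \<partial>lborel) =
          ennreal (b m) * (\<integral>\<^sup>+t. ennreal ((- ln (1 - t)) powr (s - 1) * (1 - t) powr (real (Suc m) - 1)) * indicator {0<..<1} t \<partial>lborel)"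
      by (intro nn_integral_cmult) measurable
    also have "(\<integral>\<^sup>+t. ennreal ((- ln (1 - t)) powr (s - 1) * (1 - t) powr (real (Suc m) - 1)) * indicator {0<..<1} t \<partial>lborel) =
               (\<integral>\<^sup>+t. ennreal ((- ln t) powr (s - 1) * t powr (real (Suc m) - 1)) * indicator {0<..<1} t \<partial>lborel)"
      by (rule nn_integral_reflect_unit_interval) measurable
    also have "\<dots> = ennreal (Gamma s / real (Suc m) powr s)"
      using s by (intro nn_integral_neg_ln_powr) auto
    finally show "(\<integral>\<^sup>+t. ennreal (b m) * (ennreal ((- ln (1 - t)) powr (s - 1) * (1 - t) powr (real (Suc m) - 1)) * indicator {0<..<1} t) \<partial>lborel) =
       ennreal (b m) * ennreal (Gamma s / real (Suc m) powr s)" .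
  qed
  also have "\<dots> = (\<Sum>m. ennreal (Gamma s * (b m / real (Suc m) powr s)))"
    using b s by (simp add: ennreal_mult[symmetric] mult_ac Gamma_real_nonneg del: of_nat_Suc)
  also have "\<dots> = ennreal (Gamma s * B)"
    using b s by (intro suminf_ennreal_eq sums_mult B) (auto intro!: mult_nonneg_nonneg Gamma_real_nonneg)
  finally have 2: "(\<Sum>k. ennreal (a k * W k)) = ennreal (Gamma s * B)"
    using 1 by simp
  have GB: "Gamma s * B \<ge> 0" using s B_nonneg by (simp add: Gamma_real_nonneg)
  have nonneg: "a k * W k \<ge> 0" for k using a W_nonneg by simp
  have "(\<Sum>k. ennreal (a k * W k)) \<noteq> top" by (simp add: 2)
  then have "summable (\<lambda>k. a k * W k)"
    using nonneg by (intro summable_suminf_not_top) auto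
  moreover have "(\<Sum>k. a k * W k) = Gamma s * B"
    using 2 GB calculation nonneg
    by (simp add: suminf_ennreal2 suminf_nonneg)
  ultimately show ?thesis
    unfolding a_def by (simp add: sums_iff)
qed

section \<open>Convergence and analytic continuation\<close>

lemma Gamma_series_real:
  assumes s: "s \<ge> 1"
  shows "(\<lambda>k. Re (alpha k (of_real s)) / (s + real k)) sums Gamma s"
proof -
  have "(\<lambda>k. Re (alpha k (of_real s)) * (1 / (s + real k))) sums (Gamma s * 1)"
  proof (rule alpha_series_of_weight[of s "\<lambda>m. if m = 0 then 1 else 0" "\<lambda>_. 1"])
    show "(\<lambda>m. (if m = 0 then 1 else 0) * (1 - t) ^ m) sums 1" for t :: real
    proof -
      have "(\<lambda>m. (if m = 0 then 1 else 0) * (1 - t) ^ m) = (\<lambda>m. if m = 0 then (1 - t) ^ m else 0)"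
        by auto
      then show ?thesis using sums_single[of 0 "\<lambda>m. (1 - t) ^ m"] by simp
    qed
    show "(\<lambda>m. (if m = 0 then 1 else 0) / real (Suc m) powr s) sums 1"
    proof -
      have "(\<lambda>m. (if m = 0 then 1 else 0) / real (Suc m) powr s) = (\<lambda>m. if m = 0 then 1 / real (Suc m) powr s else 0)"
        by auto
      then show ?thesis using sums_single[of 0 "\<lambda>m. 1 / real (Suc m) powr s"] by simp
    qed
    show "(\<integral>\<^sup>+t. ennreal (t powr (s + real k - 1) * 1) * indicator {0<..<1} t \<partial>lborel) = ennreal (1 / (s + real k))" for k
      using nn_integral_powr[of "s + real k"] s by simp
  qed (use s in auto)
  then show ?thesis by simp
qed

text \<open>
  The only quantitative input for convergence: the majorants are nonnegative and their series
  against \<open>1 / (1 + r + k)\<close> has the finite sum \<open>\<Gamma>(1 + r)\<close>.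
\<close>
lemma summable_alpha_majorant:
  assumes "r \<ge> 0"
  shows "summable (\<lambda>k. Re (alpha k (of_real (1 + r))) / real (Suc k))"
proof (rule summable_comparison_test')
  have "(\<lambda>k. Re (alpha k (of_real (1 + r))) / (1 + r + real k)) sums Gamma (1 + r)"
    using assms by (intro Gamma_series_real) auto
  then show "summable (\<lambda>k. (1 + r) * (Re (alpha k (of_real (1 + r))) / (1 + r + real k)))"
    by (intro summable_mult) (auto simp: sums_iff)
  fix k
  have a: "Re (alpha k (of_real (1 + r))) \<ge> 0" using assms by (intro Re_alpha_nonneg) auto
  have "1 / real (Suc k) \<le> (1 + r) / (1 + r + real k)"
    using assms by (simp add: field_simps)
  from mult_left_mono[OF this a]
  show "norm (Re (alpha k (of_real (1 + r))) / real (Suc k)) \<le> (1 + r) * (Re (alpha k (of_real (1 + r))) / (1 + r + real k))"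
    using a by (simp add: mult_ac del: of_nat_Suc)
qed

text \<open>
  The bound is demanded only for all large \<open>k\<close>, depending on the disc, so that the factors may have
  poles as long as each disc contains the poles of only finitely many of them.
\<close>
definition inverse_linear_decay :: "(nat \<Rightarrow> complex \<Rightarrow> complex) \<Rightarrow> bool" where
  "inverse_linear_decay R \<longleftrightarrow>
     (\<forall>B. \<exists>C. \<forall>\<^sub>F k in sequentially. \<forall>s. norm s \<le> B \<longrightarrow> norm (R k s) \<le> C / real (Suc k))"

lemma alpha_series_uniform_limit:
  assumes "inverse_linear_decay R"
  shows "uniform_limit (cball 0 B) (\<lambda>n s. \<Sum>k<n. alpha k s * R k s) (\<lambda>s. \<Sum>k. alpha k s * R k s) sequentially"
proof -
  define r where "r = 1 + \<bar>B\<bar>"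
  obtain C where C: "\<forall>\<^sub>F k in sequentially. \<forall>s. norm s \<le> B \<longrightarrow> norm (R k s) \<le> C / real (Suc k)"
    using assms by (auto simp: inverse_linear_decay_def)
  show ?thesis
  proof (rule Weierstrass_m_test_ev)
    show "summable (\<lambda>k. C * (Re (alpha k (of_real (1 + r))) / real (Suc k)))"
      by (intro summable_mult summable_alpha_majorant) (simp add: r_def)
    show "\<forall>\<^sub>F k in sequentially. \<forall>s\<in>cball 0 B. norm (alpha k s * R k s) \<le> C * (Re (alpha k (of_real (1 + r))) / real (Suc k))"
      using C
    proof eventually_elim
      case (elim k)
      show ?case
      proof
        fix s :: complex assume s: "s \<in> cball 0 B"
        have "norm (s - 1) \<le> r"
          using norm_triangle_ineq4[of s 1] s by (auto simp: r_def)
        then have "norm (alpha k s) * norm (R k s) \<le> Re (alpha k (of_real (1 + r))) * (C / real (Suc k))"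
          using elim s by (intro mult_mono norm_alpha_le Re_alpha_nonneg) (auto simp: r_def)
        then show "norm (alpha k s * R k s) \<le> C * (Re (alpha k (of_real (1 + r))) / real (Suc k))"
          by (simp add: norm_mult mult_ac)
      qed
    qed
  qed
qed

lemma alpha_series_summable:
  assumes "inverse_linear_decay R"
  shows "summable (\<lambda>k. alpha k s * R k s)"
  using tendsto_uniform_limitI[OF alpha_series_uniform_limit[OF assms, of "norm s"], of s]
  by (auto simp: summable_def sums_def)

lemma alpha_series_holomorphic:
  assumes "inverse_linear_decay R" "open S" "\<And>k. R k holomorphic_on S"
  shows "(\<lambda>s. \<Sum>k. alpha k s * R k s) holomorphic_on S"
proof (rule holomorphic_uniform_sequence[OF \<open>open S\<close>])
  show "(\<lambda>s. \<Sum>k<n. alpha k s * R k s) holomorphic_on S" for n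
    by (intro holomorphic_intros alpha_holomorphic assms)
  fix x assume "x \<in> S"
  then obtain d where d: "d > 0" "cball x d \<subseteq> S"
    using \<open>open S\<close> open_contains_cball by blast
  have "cball x d \<subseteq> cball 0 (norm x + d)"
    by (auto simp: dist_norm) (metis add.commute add_le_cancel_left norm_minus_commute norm_triangle_sub order_trans)
  then have "uniform_limit (cball x d) (\<lambda>n s. \<Sum>k<n. alpha k s * R k s) (\<lambda>s. \<Sum>k. alpha k s * R k s) sequentially"
    using uniform_limit_on_subset alpha_series_uniform_limit[OF assms(1)] by blast
  with d show "\<exists>d>0. cball x d \<subseteq> S \<and>
      uniform_limit (cball x d) (\<lambda>n s. \<Sum>k<n. alpha k s * R k s) (\<lambda>s. \<Sum>k. alpha k s * R k s) sequentially"
    by blast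
qed

text \<open>
  Identity theorem: a point in the interior of the ray is a limit point of the set of agreement.
\<close>
lemma holomorphic_eq_from_real_ray:
  assumes "f holomorphic_on S" "g holomorphic_on S" "open S" "connected S"
    and "\<And>x::real. x > N \<Longrightarrow> of_real x \<in> S"
    and "\<And>x::real. x > N \<Longrightarrow> f (of_real x) = g (of_real x)"
    and "s \<in> S"
  shows "f s = g s"
proof -
  have "f s - g s = 0"
  proof (rule analytic_continuation[of "\<lambda>s. f s - g s" S "of_real ` {N<..}" "of_real (N + 1)"])
    show "complex_of_real (N + 1) islimpt of_real ` {N<..}"
      unfolding islimpt_approachable
    proof (intro allI impI)
      fix e :: real assume "e > 0"
      then show "\<exists>x'\<in>complex_of_real ` {N<..}. x' \<noteq> of_real (N + 1) \<and> dist x' (of_real (N + 1)) < e"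
        by (intro bexI[of _ "of_real (N + 1 + e / 2)"]) (auto simp only: dist_of_real of_real_eq_iff dist_real_def intro!: imageI)
    qed
      show "complex_of_real (N + 1) \<in> S" using assms(5)[of "N + 1"] by simp
  qed (use assms in \<open>auto intro!: holomorphic_intros\<close>)
  then show ?thesis by simp
qed

lemma alpha_series_continuation:
  assumes R: "inverse_linear_decay R" "\<And>k. R k holomorphic_on S"
    and S: "open S" "connected S"
    and H: "H holomorphic_on S"
    and ray: "\<And>x::real. x > N \<Longrightarrow> of_real x \<in> S"
    and eq: "\<And>x::real. x > N \<Longrightarrow> (\<lambda>k. alpha k (of_real x) * R k (of_real x)) sums H (of_real x)"
    and s: "s \<in> S"
  shows "(\<lambda>k. alpha k s * R k s) sums H s"
proof -
  have "(\<Sum>k. alpha k s * R k s) = H s"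
  proof (rule holomorphic_eq_from_real_ray[where S = S and N = N and f = "\<lambda>s. \<Sum>k. alpha k s * R k s" and g = H])
    show "(\<lambda>s. \<Sum>k. alpha k s * R k s) holomorphic_on S"
      by (intro alpha_series_holomorphic R S)
  qed (use H S ray s eq in \<open>auto simp: sums_iff\<close>)
  then show ?thesis
    using alpha_series_summable[OF R(1), of s] by (simp add: sums_iff)
qed

lemma inverse_linear_decay_mult:
  assumes "inverse_linear_decay R" "continuous_on UNIV f"
  shows "inverse_linear_decay (\<lambda>k s. f s * R k s)"
  unfolding inverse_linear_decay_def
proof
  fix B
  have "compact (f ` cball 0 B)"
    by (intro compact_continuous_image continuous_on_subset[OF assms(2)]) auto
  then obtain M where "\<forall>y\<in>f ` cball 0 B. norm y \<le> M"
    by (meson bounded_iff compact_imp_bounded)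
  then have M: "norm (f s) \<le> M" if "norm s \<le> B" for s :: complex
    using that by simp
  obtain C where C: "\<forall>\<^sub>F k in sequentially. \<forall>s. norm s \<le> B \<longrightarrow> norm (R k s) \<le> C / real (Suc k)"
    using assms(1) by (auto simp: inverse_linear_decay_def)
  show "\<exists>C. \<forall>\<^sub>F k in sequentially. \<forall>s. norm s \<le> B \<longrightarrow> norm (f s * R k s) \<le> C / real (Suc k)"
  proof (rule exI[of _ "M * C"], use C in eventually_elim, intro allI impI)
    fix k and s :: complex assume k: "\<forall>s. norm s \<le> B \<longrightarrow> norm (R k s) \<le> C / real (Suc k)" and s: "norm s \<le> B"
    have "norm (f s) * norm (R k s) \<le> M * (C / real (Suc k))"
      using k s M[OF s] by (intro mult_mono) (auto intro: order_trans[OF norm_ge_zero])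
    then show "norm (f s * R k s) \<le> M * C / real (Suc k)" by (simp add: norm_mult)
  qed
qed

lemma inverse_linear_decay_sum:
  assumes "\<And>i. i \<in> I \<Longrightarrow> inverse_linear_decay (R i)"
  shows "inverse_linear_decay (\<lambda>k s. \<Sum>i\<in>I. R i k s)"
  unfolding inverse_linear_decay_def
proof
  fix B
  show "\<exists>C. \<forall>\<^sub>F k in sequentially. \<forall>s. norm s \<le> B \<longrightarrow> norm (\<Sum>i\<in>I. R i k s) \<le> C / real (Suc k)"
  proof (cases "finite I")
    case True
    have "\<forall>i\<in>I. \<exists>C. \<forall>\<^sub>F k in sequentially. \<forall>s. norm s \<le> B \<longrightarrow> norm (R i k s) \<le> C / real (Suc k)"
      using assms by (auto simp: inverse_linear_decay_def)
    from bchoice[OF this] obtain C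
      where "\<forall>i\<in>I. \<forall>\<^sub>F k in sequentially. \<forall>s. norm s \<le> B \<longrightarrow> norm (R i k s) \<le> C i / real (Suc k)" ..
    then have "\<forall>\<^sub>F k in sequentially. \<forall>i\<in>I. \<forall>s. norm s \<le> B \<longrightarrow> norm (R i k s) \<le> C i / real (Suc k)"
      using True by (simp add: eventually_ball_finite)
    then have "\<forall>\<^sub>F k in sequentially. \<forall>s. norm s \<le> B \<longrightarrow> norm (\<Sum>i\<in>I. R i k s) \<le> sum C I / real (Suc k)"
      by eventually_elim (auto simp: sum_divide_distrib intro!: sum_norm_le)
    then show ?thesis by blast
  qed (auto intro!: exI[of _ 0])
qed

lemma inverse_linear_decay_shift: "inverse_linear_decay (\<lambda>k s. 1 / (s + of_nat k - c))"
  unfolding inverse_linear_decay_def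
proof
  fix B
  have "\<forall>\<^sub>F k in sequentially. \<forall>s. norm s \<le> B \<longrightarrow> norm (1 / (s + of_nat k - c)) \<le> 2 / real (Suc k)"
    using eventually_ge_at_top[of "nat \<lceil>2 * (\<bar>B\<bar> + norm c) + 1\<rceil>"]
  proof eventually_elim
    case (elim k)
    then have k: "real k \<ge> 2 * (\<bar>B\<bar> + norm c) + 1" by linarith
    show ?case
    proof (intro allI impI)
      fix s :: complex assume s: "norm s \<le> B"
      have "norm (of_nat k - (c - s)) \<ge> norm (of_nat k :: complex) - norm (c - s)"
        by (rule norm_triangle_ineq2)
      moreover have "norm (c - s) \<le> norm c + norm s" by (rule norm_triangle_ineq4)
      ultimately have "norm (s + of_nat k - c) \<ge> real (Suc k) / 2"
        using s k by (simp add: algebra_simps)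
      then have "1 / norm (s + of_nat k - c) \<le> 1 / (real (Suc k) / 2)"
        by (intro divide_left_mono) (auto intro!: mult_pos_pos)
      then show "norm (1 / (s + of_nat k - c)) \<le> 2 / real (Suc k)"
        by (simp add: norm_divide)
    qed
  qed
  then show "\<exists>C. \<forall>\<^sub>F k in sequentially. \<forall>s. norm s \<le> B \<longrightarrow> norm (1 / (s + of_nat k - c)) \<le> C / real (Suc k)"
    by blast
qed

text \<open>
  Comparison with the telescoping series of
  \<open>1 / ((x - 1 + n) * (x + n)) = 1 / (x - 1 + n) - 1 / (x + n)\<close> for \<open>x = Re z\<close>.
\<close>
lemma norm_trigamma_le:
  fixes z :: complex
  assumes "Re z > 1"
  shows "norm (Polygamma 1 z) \<le> 1 / (Re z - 1)"
proof -
  define x where "x = Re z"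
  have x: "x > 1" using assms by (simp add: x_def)
  have z: "z \<noteq> 0" using assms by auto
  have P: "(\<lambda>n. inverse ((z + of_nat n) ^ 2)) sums Polygamma 1 z"
    using Polygamma_LIMSEQ[OF z, of 1] by (simp add: eval_nat_numeral)
  have lim: "(\<lambda>n. 1 / (x - 1 + real n)) \<longlonglongrightarrow> 0"
    by real_asymp
  have T: "(\<lambda>n. 1 / (x - 1 + real n) - 1 / (x - 1 + real (Suc n))) sums (1 / (x - 1 + real 0) - 0)"
    by (rule telescope_sums'[OF lim])
  have le: "norm (inverse ((z + of_nat n) ^ 2)) \<le> 1 / (x - 1 + real n) - 1 / (x - 1 + real (Suc n))" for n
  proof -
    have "x + real n \<le> norm (z + of_nat n)"
      using complex_Re_le_cmod[of "z + of_nat n"] by (simp add: x_def)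
    then have "norm (inverse ((z + of_nat n) ^ 2)) \<le> 1 / (x + real n) ^ 2"
      unfolding norm_inverse norm_power
      unfolding inverse_eq_divide
      using x by (intro divide_left_mono power_mono mult_pos_pos zero_less_power) auto
    also have "\<dots> \<le> 1 / ((x - 1 + real n) * (x + real n))"
      unfolding power2_eq_square using x by (intro divide_left_mono mult_right_mono mult_pos_pos) auto
    also have "\<dots> = 1 / (x - 1 + real n) - 1 / (x - 1 + real (Suc n))"
      using x by (simp add: field_simps)
    finally show ?thesis .
  qed
  have "summable (\<lambda>n. norm (inverse ((z + of_nat n) ^ 2)))"
    by (rule summable_comparison_test'[of _ 0, OF sums_summable[OF T]]) (use le in simp)
  then have "norm (\<Sum>n. inverse ((z + of_nat n) ^ 2)) \<le> (\<Sum>n. norm (inverse ((z + of_nat n) ^ 2)))"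
    by (rule summable_norm)
  also have "\<dots> \<le> (\<Sum>n. 1 / (x - 1 + real n) - 1 / (x - 1 + real (Suc n)))"
    by (intro suminf_le le sums_summable[OF T]) fact
  also have "\<dots> = 1 / (x - 1)"
    using T by (simp add: sums_iff)
  finally show ?thesis
    using P by (simp add: sums_iff x_def)
qed

lemma inverse_linear_decay_trigamma: "inverse_linear_decay (\<lambda>k s. Polygamma 1 (s + of_nat k))"
  unfolding inverse_linear_decay_def
proof
  fix B
  have "\<forall>\<^sub>F k in sequentially. \<forall>s. norm s \<le> B \<longrightarrow> norm (Polygamma 1 (s + of_nat k) :: complex) \<le> 2 / real (Suc k)"
    using eventually_ge_at_top[of "nat \<lceil>2 * \<bar>B\<bar> + 3\<rceil>"]
  proof eventually_elim
    case (elim k)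
    then have k: "real k \<ge> 2 * \<bar>B\<bar> + 3" by linarith
    show ?case
    proof (intro allI impI)
      fix s :: complex assume s: "norm s \<le> B"
      have Re: "Re (s + of_nat k) - 1 \<ge> real (Suc k) / 2"
        using abs_Re_le_cmod[of s] s k by simp
      then have "norm (Polygamma 1 (s + of_nat k)) \<le> 1 / (Re (s + of_nat k) - 1)"
        by (intro norm_trigamma_le) auto
      also have "\<dots> \<le> 1 / (real (Suc k) / 2)"
        using Re by (intro divide_left_mono mult_pos_pos) auto
      finally show "norm (Polygamma 1 (s + of_nat k)) \<le> 2 / real (Suc k)" by simp
    qed
  qed
  then show "\<exists>C. \<forall>\<^sub>F k in sequentially. \<forall>s. norm s \<le> B \<longrightarrow> norm (Polygamma 1 (s + of_nat k) :: complex) \<le> C / real (Suc k)"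
    by blast
qed

text \<open>
  The common domain of the identities; it is connected because only countably many points are
  removed from the plane.
\<close>
definition off_integers_upto :: "int \<Rightarrow> complex set" where
  "off_integers_upto c = - of_int ` {..c}"

lemma open_off_integers_upto: "open (off_integers_upto c)"
  unfolding off_integers_upto_def by (intro open_Compl closed_of_int_image)

lemma connected_off_integers_upto: "connected (off_integers_upto c)"
  unfolding off_integers_upto_def
  by (intro path_connected_imp_connected path_connected_complement_countable) auto

lemma of_real_in_off_integers_upto: "x > of_int c \<Longrightarrow> of_real x \<in> off_integers_upto c"
  unfolding off_integers_upto_def by (auto dest!: arg_cong[of _ _ Re])

lemma off_integers_upto_neq:
  assumes "s \<in> off_integers_upto c" "m \<le> c"
  shows "s \<noteq> of_int m"
  using assms by (auto simp: off_integers_upto_def)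

lemma off_integers_upto_not_nonpos_Ints:
  assumes "s \<in> off_integers_upto c" "c \<ge> 0"
  shows "s \<notin> \<int>\<^sub>\<le>\<^sub>0"
  using assms by (force simp: off_integers_upto_def elim!: nonpos_Ints_cases)

section \<open>The weights 1 / t ^ (j + 1)\<close>

lemma sums_negative_binomial:
  fixes x :: real
  assumes "\<bar>x\<bar> < 1"
  shows "(\<lambda>m. real ((m + j) choose j) * x ^ m) sums (1 / (1 - x) ^ Suc j)"
proof -
  have "(\<lambda>m. ((- real (Suc j)) gchoose m) * (- x) ^ m) sums (1 + (- x)) powr (- real (Suc j))"
    using assms by (intro gen_binomial_real) auto
  moreover have "((- real (Suc j)) gchoose m) * (- x) ^ m = real ((m + j) choose j) * x ^ m" for m
  proof -
    have "(- real (Suc j)) gchoose m = (-1) ^ m * ((real (m + j)) gchoose m)"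
      by (subst gbinomial_negated_upper) (simp add: algebra_simps)
    also have "real (m + j) gchoose m = real ((m + j) choose j)"
      using binomial_symmetric[of j "m + j"] by (simp add: binomial_gbinomial)
    finally show ?thesis
      by (simp add: mult.assoc mult.left_commute[of "(-1) ^ m"] power_mult_distrib[symmetric])
  qed
  moreover have "(1 + (- x)) powr (- real (Suc j)) = 1 / (1 - x) ^ Suc j"
  proof -
    have "(1 - x) powr real (Suc j) = (1 - x) ^ Suc j"
      using assms by (intro powr_realpow) auto
    then show ?thesis by (simp add: powr_minus inverse_eq_divide del: of_nat_Suc power_Suc)
  qed
  ultimately show ?thesis by simp
qed

text \<open>
  Both sides are the rising factorial of \<open>m + 1\<close>.
\<close>
lemma fact_mult_binomial: "fact j * real ((m + j) choose j) = (\<Prod>i<j. real (Suc m + i))"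
proof -
  have "fact j * real ((m + j) choose j) = fact (m + j) / fact m"
    using binomial_fact[of j "m + j", where 'a = real] by simp
  also have "(fact (m + j) :: real) = fact m * pochhammer (real (Suc m)) j"
    by (induction j) (simp_all add: pochhammer_Suc algebra_simps)
  also have "\<dots> / fact m = pochhammer (real (Suc m)) j"
    by simp
  finally show ?thesis
    by (simp add: pochhammer_prod atLeast0LessThan add.assoc)
qed

lemma binomial_le_power: "real ((m + j) choose j) \<le> real (Suc m) ^ j"
proof -
  have "real (Suc m + i) \<le> real (Suc i) * real (Suc m)" for i
    by (simp add: algebra_simps)
  then have "(\<Prod>i<j. real (Suc m + i)) \<le> (\<Prod>i<j. real (Suc i) * real (Suc m))"
    by (intro prod_mono) auto
  also have "\<dots> = fact j * real (Suc m) ^ j"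
    by (induction j) (simp_all add: algebra_simps)
  finally have "fact j * real ((m + j) choose j) \<le> fact j * real (Suc m) ^ j"
    unfolding fact_mult_binomial .
  then show ?thesis
    by (rule mult_left_le_imp_le) simp
qed

lemma summable_binomial_powr:
  fixes s :: real
  assumes "s > real j + 1"
  shows "summable (\<lambda>m. real ((m + j) choose j) / real (Suc m) powr s)"
proof (rule summable_comparison_test')
  have "summable (\<lambda>n. real n powr (real j - s))"
    using assms by (subst summable_real_powr_iff) auto
  then show "summable (\<lambda>m. real (Suc m) powr (real j - s))"
    by (subst summable_Suc_iff)
  fix m
  have "real ((m + j) choose j) / real (Suc m) powr s \<le> real (Suc m) ^ j / real (Suc m) powr s"
    by (intro divide_right_mono binomial_le_power) auto
  also have "\<dots> = real (Suc m) powr (real j - s)"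
    by (simp add: powr_diff powr_realpow del: of_nat_Suc)
  finally show "norm (real ((m + j) choose j) / real (Suc m) powr s) \<le> real (Suc m) powr (real j - s)"
    by simp
qed

lemma alpha_series_binomial:
  fixes s :: real
  assumes s: "s > real j + 1"
  shows "(\<lambda>k. Re (alpha k (of_real s)) / (s + real k - real j - 1)) sums
           (Gamma s * (\<Sum>m. real ((m + j) choose j) / real (Suc m) powr s))"
proof -
  have "(\<lambda>k. Re (alpha k (of_real s)) * (1 / (s + real k - real j - 1))) sums
           (Gamma s * (\<Sum>m. real ((m + j) choose j) / real (Suc m) powr s))"
  proof (rule alpha_series_of_weight[of s "\<lambda>m. real ((m + j) choose j)" "\<lambda>t. 1 / t ^ Suc j"])
    show "(\<lambda>m. real ((m + j) choose j) * (1 - t) ^ m) sums (1 / t ^ Suc j)" if "0 < t" "t < 1" for t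
      using sums_negative_binomial[of "1 - t" j] that by simp
    show "(\<integral>\<^sup>+t. ennreal (t powr (s + real k - 1) * (1 / t ^ Suc j)) * indicator {0<..<1} t \<partial>lborel) =
            ennreal (1 / (s + real k - real j - 1))" for k
    proof -
      have "(\<integral>\<^sup>+t. ennreal (t powr (s + real k - 1) * (1 / t ^ Suc j)) * indicator {0<..<1} t \<partial>lborel) =
            (\<integral>\<^sup>+t. ennreal (t powr ((s + real k - real j - 1) - 1)) * indicator {0<..<1} t \<partial>lborel)"
      proof (intro nn_integral_cong)
        fix t :: real
        have "t powr (s + real k - 1) * (1 / t ^ Suc j) = t powr ((s + real k - real j - 1) - 1)" if "0 < t"
        proof -
          have "t powr (s + real k - 1) / t powr real (Suc j) = t powr (s + real k - 1 - real (Suc j))"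
            by (rule powr_diff[symmetric])
          moreover have "t powr real (Suc j) = t ^ Suc j"
            using that by (rule powr_realpow)
          ultimately show ?thesis by (simp add: algebra_simps del: power_Suc)
        qed
        then show "ennreal (t powr (s + real k - 1) * (1 / t ^ Suc j)) * indicator {0<..<1} t =
            ennreal (t powr ((s + real k - real j - 1) - 1)) * indicator {0<..<1} t"
          by (auto simp: indicator_def)
      qed
      also have "\<dots> = ennreal (1 / (s + real k - real j - 1))"
        using s by (intro nn_integral_powr) auto
      finally show ?thesis .
    qed
    show "(\<lambda>m. real ((m + j) choose j) / real (Suc m) powr s) sums (\<Sum>m. real ((m + j) choose j) / real (Suc m) powr s)"
      using summable_binomial_powr[OF s] by (rule summable_sums)
  qed (use s in auto)
  then show ?thesis by simp
qed

section \<open>The Riemann zeta function\<close>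

lemma summable_Dirichlet:
  assumes "Re s > 1"
  shows "summable (\<lambda>n. of_nat (Suc n) powr (- s))"
proof (rule summable_norm_cancel)
  have "summable (\<lambda>n. real n powr (- Re s))"
    using assms by (subst summable_real_powr_iff) auto
  then have "summable (\<lambda>n. real (Suc n) powr (- Re s))"
    by (subst summable_Suc_iff)
  moreover have "norm (of_nat (Suc n) powr (- s)) = real (Suc n) powr (- Re s)" for n
    by (subst norm_powr_real_powr) (auto simp del: of_nat_Suc)
  ultimately show "summable (\<lambda>n. norm (of_nat (Suc n) powr (- s)))"
    by simp
qed

lemma holomorphic_Dirichlet: "(\<lambda>s. \<Sum>n. of_nat (Suc n) powr (- s)) holomorphic_on {s. Re s > 1}"
proof (rule holomorphic_uniform_sequence)
  show "open {s. Re s > 1}" by (rule open_halfspace_Re_gt)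
  show "(\<lambda>s. \<Sum>n<N. of_nat (Suc n) powr (- s)) holomorphic_on {s. Re s > 1}" for N
    by (intro holomorphic_intros) (auto simp del: of_nat_Suc)
  fix x :: complex assume "x \<in> {s. Re s > 1}"
  then have x: "Re x > 1" by simp
  \<comment> \<open>Half the distance to the boundary line leaves a real part bounded away from \<open>1\<close> on the disc.\<close>
  define d where "d = (Re x - 1) / 2"
  have d: "d > 0" using x by (simp add: d_def)
  have Re: "Re y \<ge> 1 + d" if "y \<in> cball x d" for y
    using abs_Re_le_cmod[of "x - y"] that by (simp add: dist_norm d_def field_simps)
  have "uniform_limit (cball x d) (\<lambda>N s. \<Sum>n<N. of_nat (Suc n) powr (- s)) (\<lambda>s. \<Sum>n. of_nat (Suc n) powr (- s)) sequentially"
  proof (rule Weierstrass_m_test)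
    have "summable (\<lambda>n. real n powr (- (1 + d)))"
      using d by (subst summable_real_powr_iff) auto
    then show "summable (\<lambda>n. real (Suc n) powr (- (1 + d)))"
      by (subst summable_Suc_iff)
    fix n y assume y: "y \<in> cball x d"
    have "norm (of_nat (Suc n) powr (- y)) = real (Suc n) powr (- Re y)"
      by (subst norm_powr_real_powr) (auto simp del: of_nat_Suc)
    also have "\<dots> \<le> real (Suc n) powr (- (1 + d))"
      using Re[OF y] by (intro powr_mono) auto
    finally show "norm (of_nat (Suc n) powr (- y)) \<le> real (Suc n) powr (- (1 + d))" .
  qed
  moreover have "cball x d \<subseteq> {s. Re s > 1}"
    using Re d by force
  ultimately show "\<exists>d>0. cball x d \<subseteq> {s. Re s > 1} \<and>
      uniform_limit (cball x d) (\<lambda>N s. \<Sum>n<N. of_nat (Suc n) powr (- s)) (\<lambda>s. \<Sum>n. of_nat (Suc n) powr (- s)) sequentially"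
    using d by blast
qed

lemma of_nat_powr_of_real:
  "of_nat (Suc n) powr (- complex_of_real x) = of_real (real (Suc n) powr (- x))"
proof -
  have "of_nat (Suc n) = complex_of_real (real (Suc n))" by simp
  then have "of_nat (Suc n) powr (- complex_of_real x) = complex_of_real (real (Suc n)) powr of_real (- x)"
    by (simp only: of_real_minus)
  also have "\<dots> = of_real (real (Suc n) powr (- x))"
    by (rule powr_of_real) simp
  finally show ?thesis .
qed

text \<open>
  The entire function \<open>1 / \<Gamma>\<close> vanishes at \<open>1 - k\<close> for \<open>k > 0\<close>, so its quotient by \<open>s + k - 1\<close>
  has a removable singularity there; the derivative is the value that removes it.
\<close>
definition rGamma_quotient :: "nat \<Rightarrow> complex \<Rightarrow> complex" where
  "rGamma_quotient k s =
     (if k > 0 \<and> s = 1 - of_nat k then deriv rGamma s else rGamma s / (s + of_nat k - 1))"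

lemma rGamma_quotient_holomorphic: "rGamma_quotient k holomorphic_on - {1}"
proof (cases "k = 0")
  case True
  have "(\<lambda>s. rGamma s / (s - 1)) holomorphic_on - {1}"
    by (intro holomorphic_intros) auto
  then show ?thesis using True by (simp add: rGamma_quotient_def[abs_def])
next
  case False
  have "rGamma_quotient k holomorphic_on UNIV"
  proof (rule pole_theorem_0[of rGamma _ "1 - of_nat k"])
    have "1 - of_nat k = (of_int (1 - int k) :: complex)" by simp
    then have "(1 - of_nat k :: complex) \<in> \<int>\<^sub>\<le>\<^sub>0"
      using False by (simp only: nonpos_Ints_of_int) 
    then show "rGamma (1 - of_nat k :: complex) = 0"
      by (simp add: rGamma_eq_zero_iff)
    show "rGamma z = (z - (1 - of_nat k)) * rGamma_quotient k z" if "z \<in> UNIV - {1 - of_nat k}" for z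
    proof -
      have "z - (1 - of_nat k) \<noteq> 0" using that by simp
      moreover have "rGamma_quotient k z = rGamma z / (z - (1 - of_nat k))"
        using that by (simp add: rGamma_quotient_def algebra_simps)
      ultimately show ?thesis by simp
    qed
  qed (use False in \<open>auto simp: rGamma_quotient_def intro!: holomorphic_intros\<close>)
  then show ?thesis by (rule holomorphic_on_subset) auto
qed

lemma inverse_linear_decay_cong:
  assumes R: "inverse_linear_decay R"
    and eq: "\<And>B. \<forall>\<^sub>F k in sequentially. \<forall>s. norm s \<le> B \<longrightarrow> R' k s = R k s"
  shows "inverse_linear_decay R'"
  unfolding inverse_linear_decay_def
proof
  fix B
  obtain C where "\<forall>\<^sub>F k in sequentially. \<forall>s. norm s \<le> B \<longrightarrow> norm (R k s) \<le> C / real (Suc k)"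
    using R by (auto simp: inverse_linear_decay_def)
  with eq[of B] have "\<forall>\<^sub>F k in sequentially. \<forall>s. norm s \<le> B \<longrightarrow> norm (R' k s) \<le> C / real (Suc k)"
    by eventually_elim simp
  then show "\<exists>C. \<forall>\<^sub>F k in sequentially. \<forall>s. norm s \<le> B \<longrightarrow> norm (R' k s) \<le> C / real (Suc k)"
    by blast
qed

lemma inverse_linear_decay_rGamma_quotient: "inverse_linear_decay rGamma_quotient"
proof -
  have "inverse_linear_decay (\<lambda>k s. rGamma s * (1 / (s + of_nat k - 1)))"
    by (intro inverse_linear_decay_mult inverse_linear_decay_shift holomorphic_on_imp_continuous_on holomorphic_rGamma)
  moreover have "\<forall>\<^sub>F k in sequentially. \<forall>s. norm s \<le> B \<longrightarrow> rGamma_quotient k s = rGamma s * (1 / (s + of_nat k - 1))" for B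
    using eventually_ge_at_top[of "nat \<lceil>\<bar>B\<bar> + 2\<rceil>"]
  proof eventually_elim
    case (elim k)
    then have k: "real k \<ge> \<bar>B\<bar> + 2" by linarith
    show ?case
    proof (intro allI impI)
      fix s :: complex assume s: "norm s \<le> B"
      have "s \<noteq> 1 - of_nat k"
      proof
        assume "s = 1 - of_nat k"
        then have "Re s = 1 - real k" by simp
        then show False using abs_Re_le_cmod[of s] s k by linarith
      qed
      then show "rGamma_quotient k s = rGamma s * (1 / (s + of_nat k - 1))"
        by (simp add: rGamma_quotient_def)
    qed
  qed
  ultimately show ?thesis
    by (rule inverse_linear_decay_cong)
qed

text \<open>
  The series \<open>\<Sum>k. \<alpha> k s / (s + k - 1)\<close> represents \<open>\<Gamma>(s)\<close> times the Dirichlet series for real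
  \<open>s > 1\<close>. Multiplied termwise by \<open>1 / \<Gamma>(s)\<close> it stays locally uniformly convergent away from \<open>1\<close>,
  and it agrees with the Dirichlet series on the half-plane by the identity theorem.
\<close>
lemma zeta_exists:
  "\<exists>f. f holomorphic_on - {1} \<and> (\<forall>s. Re s > 1 \<longrightarrow> (\<lambda>n. of_nat (Suc n) powr (- s)) sums f s)"
proof -
  define f where "f = (\<lambda>s. \<Sum>k. alpha k s * rGamma_quotient k s)"
  have f: "f holomorphic_on - {1}"
    unfolding f_def
    by (intro alpha_series_holomorphic inverse_linear_decay_rGamma_quotient rGamma_quotient_holomorphic) auto
  have real: "f (of_real x) = (\<Sum>n. of_nat (Suc n) powr (- of_real x))" if x: "x > 1" for x
  proof -
    define Z where "Z = (\<Sum>n. 1 / real (Suc n) powr x)"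
    have "(\<lambda>k. Re (alpha k (of_real x)) / (x + real k - 1)) sums (Gamma x * Z)"
      using alpha_series_binomial[of 0 x] x by (simp add: Z_def)
    then have "(\<lambda>k. of_real (inverse (Gamma x) * (Re (alpha k (of_real x)) / (x + real k - 1))) :: complex) sums
        of_real (inverse (Gamma x) * (Gamma x * Z))"
      by (intro sums_of_real sums_mult)
    moreover have "of_real (inverse (Gamma x) * (Re (alpha k (of_real x)) / (x + real k - 1))) =
        alpha k (of_real x) * rGamma_quotient k (of_real x)" for k
    proof -
      have "complex_of_real x \<noteq> 1 - of_nat k"
      proof
        assume "complex_of_real x = 1 - of_nat k"
        from arg_cong[OF this, of Re] show False using x by simp
      qed
      then have "rGamma_quotient k (of_real x) = of_real (inverse (Gamma x) / (x + real k - 1))"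
        by (simp add: rGamma_quotient_def rGamma_inverse_Gamma Gamma_complex_of_real)
      moreover have "alpha k (of_real x) = of_real (Re (alpha k (of_real x)))"
        using x by (intro alpha_of_real) auto
      ultimately have "alpha k (of_real x) * rGamma_quotient k (of_real x) =
          of_real (Re (alpha k (of_real x))) * of_real (inverse (Gamma x) / (x + real k - 1))"
        by (simp only:)
      then show ?thesis by (simp add: mult_ac)
    qed
    moreover have "inverse (Gamma x) * (Gamma x * Z) = Z"
    proof -
      have "0 < x" using x by simp
      from Gamma_real_pos[OF this] have "Gamma x \<noteq> 0" by simp
      then show ?thesis by simp
    qed
    ultimately have "f (of_real x) = of_real Z"
      by (simp add: f_def sums_iff)
    moreover have "(\<lambda>n. of_nat (Suc n) powr (- of_real x)) sums (of_real Z :: complex)"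
    proof -
      have "(\<lambda>n. 1 / real (Suc n) powr x) sums Z"
        using summable_binomial_powr[of 0 x] x by (simp add: Z_def summable_sums)
      then show ?thesis
        unfolding of_nat_powr_of_real by (intro sums_of_real) (simp add: powr_minus inverse_eq_divide)
    qed
    ultimately show ?thesis by (simp add: sums_iff)
  qed
  have "(\<lambda>n. of_nat (Suc n) powr (- s)) sums f s" if s: "Re s > 1" for s
  proof -
    have "f s = (\<Sum>n. of_nat (Suc n) powr (- s))"
    proof (rule holomorphic_eq_from_real_ray[where S = "{s. Re s > 1}" and N = 1 and f = f
             and g = "\<lambda>s. \<Sum>n. of_nat (Suc n) powr (- s)"])
      show "f holomorphic_on {s. Re s > 1}"
        by (rule holomorphic_on_subset[OF f]) auto
      show "connected {s. Re s > 1}"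
        by (intro convex_connected convex_halfspace_Re_gt)
    qed (use s real holomorphic_Dirichlet in \<open>auto simp: open_halfspace_Re_gt\<close>)
    with summable_Dirichlet[OF s] show ?thesis by (simp add: sums_iff)
  qed
  with f show ?thesis by blast
qed

lemma zeta_holomorphic: "zeta holomorphic_on - {1}"
  and zeta_sums: "Re s > 1 \<Longrightarrow> (\<lambda>n. of_nat (Suc n) powr (- s)) sums zeta s"
  using someI_ex[OF zeta_exists] unfolding zeta_def by blast+

lemma zeta_sums_real:
  assumes "x > 1"
  shows "(\<lambda>n. of_real (real (Suc n) powr (- x))) sums zeta (of_real x)"
  using zeta_sums[of "of_real x"] assms unfolding of_nat_powr_of_real by simp

section \<open>The identities for large real arguments\<close>

text \<open>
  The defining expansion of the Stirling numbers at the negative argument \<open>- (m + 1)\<close>, where falling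
  factorials become signed rising ones.
\<close>
lemma power_Suc_eq_sum_Stirling_binomial:
  assumes "l \<ge> 1"
  shows "real (Suc m) ^ l =
           (\<Sum>j=1..l. (-1) ^ (l + j) * fact j * real (Stirling l j) * real ((m + j) choose j))"
proof -
  have "(- real (Suc m)) ^ l = (\<Sum>j=1..l. real (Stirling l j) * (\<Prod>i<j. - real (Suc m) - real i))"
    by (rule power_eq_sum_Stirling[OF assms])
  also have "\<dots> = (\<Sum>j=1..l. real (Stirling l j) * ((-1) ^ j * (fact j * real ((m + j) choose j))))"
  proof (intro sum.cong refl)
    fix j
    have "(\<Prod>i<j. - real (Suc m) - real i) = (\<Prod>i<j. (-1) * real (Suc m + i))"
      by (intro prod.cong) auto
    also have "\<dots> = (-1) ^ j * (\<Prod>i<j. real (Suc m + i))"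
      by (simp only: prod.distrib prod_constant card_lessThan)
    finally show "real (Stirling l j) * (\<Prod>i<j. - real (Suc m) - real i) =
        real (Stirling l j) * ((-1) ^ j * (fact j * real ((m + j) choose j)))"
      by (simp only: fact_mult_binomial)
  qed
  finally have "(-1) ^ l * (- real (Suc m)) ^ l =
      (\<Sum>j=1..l. (-1) ^ (l + j) * fact j * real (Stirling l j) * real ((m + j) choose j))"
    by (simp only: sum_distrib_left power_add mult_ac)
  then show ?thesis
    by (simp only: power_mult_distrib[symmetric]) (simp add: add.commute)
qed

lemma alpha_series_pole_real:
  fixes s :: real
  assumes "s > real j + 1"
  shows "(\<lambda>k. alpha k (of_real s) * (1 / (of_real s + of_nat k - of_nat j - 1))) sums
           of_real (Gamma s * (\<Sum>m. real ((m + j) choose j) / real (Suc m) powr s))"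
proof -
  have "alpha k (of_real s) * (1 / (of_real s + of_nat k - of_nat j - 1)) =
        of_real (Re (alpha k (of_real s)) / (s + real k - real j - 1))" for k
    using assms by (subst alpha_of_real) auto
  then show ?thesis
    using sums_of_real[OF alpha_series_binomial[OF assms]] by (simp only:)
qed

text \<open>
  The combination of the weights \<open>1 / t ^ (j + 1)\<close> is chosen so that the coefficients \<open>b m\<close> add up to
  \<open>(m + 1) ^ l\<close>, which shifts the argument of the zeta function by \<open>l\<close>.
\<close>
lemma alpha_series_Stirling_real:
  fixes s :: real
  assumes l: "l \<ge> 1" and s: "s > real l + 1"
  shows "(\<lambda>k. alpha k (of_real s) *
           (\<Sum>j=1..l. (-1) ^ (l + j) *
              (fact j * of_nat (Stirling l j) / (of_real s + of_nat k - of_nat j - 1))))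
          sums (Gamma (of_real s) * zeta (of_real s - of_nat l))"
proof -
  define c :: "nat \<Rightarrow> real" where "c = (\<lambda>j. (-1) ^ (l + j) * fact j * real (Stirling l j))"
  define B where "B = (\<lambda>j. \<Sum>m. real ((m + j) choose j) / real (Suc m) powr s)"
  have "(\<lambda>k. \<Sum>j=1..l. of_real (c j) * (alpha k (of_real s) * (1 / (of_real s + of_nat k - of_nat j - 1))))
      sums (\<Sum>j=1..l. of_real (c j) * complex_of_real (Gamma s * B j))"
    unfolding B_def using s by (intro sums_sum sums_mult alpha_series_pole_real) auto
  also have "(\<lambda>k. \<Sum>j=1..l. of_real (c j) * (alpha k (of_real s) * (1 / (of_real s + of_nat k - of_nat j - 1)))) =
      (\<lambda>k. alpha k (of_real s) *
           (\<Sum>j=1..l. (-1) ^ (l + j) *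
              (fact j * of_nat (Stirling l j) / (of_real s + of_nat k - of_nat j - 1))))"
    unfolding sum_distrib_left by (intro ext sum.cong refl) (simp add: c_def)
  also have "(\<Sum>j=1..l. of_real (c j) * complex_of_real (Gamma s * B j)) =
      of_real (Gamma s) * of_real (\<Sum>j=1..l. c j * B j)"
    by (simp add: sum_distrib_left mult_ac)
  also have "of_real (\<Sum>j=1..l. c j * B j) = zeta (of_real (s - real l))"
  proof -
    have "(\<lambda>m. \<Sum>j=1..l. c j * (real ((m + j) choose j) / real (Suc m) powr s)) sums (\<Sum>j=1..l. c j * B j)"
      unfolding B_def using s by (intro sums_sum sums_mult summable_sums summable_binomial_powr) auto
    moreover have "(\<Sum>j=1..l. c j * (real ((m + j) choose j) / real (Suc m) powr s)) = real (Suc m) powr (- (s - real l))" for m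
    proof -
      have "(\<Sum>j=1..l. c j * (real ((m + j) choose j) / real (Suc m) powr s)) = real (Suc m) ^ l / real (Suc m) powr s"
        unfolding power_Suc_eq_sum_Stirling_binomial[OF l] c_def sum_divide_distrib by simp
      also have "\<dots> = real (Suc m) powr (- (s - real l))"
        by (simp add: powr_realpow powr_diff del: of_nat_Suc)
      finally show ?thesis .
    qed
    ultimately have "(\<lambda>m. of_real (real (Suc m) powr (- (s - real l)))) sums complex_of_real (\<Sum>j=1..l. c j * B j)"
      by (intro sums_of_real) (simp only:)
    then show ?thesis
      using zeta_sums_real[of "s - real l"] s sums_unique2 by fastforce
  qed
  finally show ?thesis
    by (simp add: Gamma_complex_of_real)
qed

lemma sums_neg_ln_quotient:
  fixes t :: real
  assumes "0 < t" "t < 1"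
  shows "(\<lambda>m. 1 / real (Suc m) * (1 - t) ^ m) sums (- ln t / (1 - t))"
proof -
  have "(\<lambda>n. - ((1 - t) ^ n) / real n) sums ln t"
    using ln_series'[of "t - 1"] assms by simp
  then have "(\<lambda>n. (1 - t) ^ n / real n) sums (- ln t)"
    using sums_minus by fastforce
  then have "(\<lambda>n. (1 - t) ^ Suc n / real (Suc n)) sums (- ln t)"
    by (subst sums_Suc_iff) simp
  then have "(\<lambda>n. (1 - t) ^ Suc n / real (Suc n) / (1 - t)) sums (- ln t / (1 - t))"
    by (rule sums_divide)
  then show ?thesis using assms by simp
qed

lemma trigamma_sums:
  fixes z :: "'a :: {real_normed_field, banach}"
  assumes "z \<noteq> 0"
  shows "(\<lambda>n. 1 / (z + of_nat n) ^ 2) sums Polygamma 1 z"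
  using Polygamma_LIMSEQ[OF assms, of 1] by (simp add: eval_nat_numeral divide_inverse)

text \<open>
  Expand \<open>1 / (1 - t)\<close> in the geometric series; each term is the case \<open>s = 2\<close> of
  \<open>nn_integral_neg_ln_powr\<close> and contributes \<open>\<Gamma>(2) / (z + n)\<^sup>2\<close>.
\<close>
lemma nn_integral_trigamma:
  fixes z :: real
  assumes z: "z > 0"
  shows "(\<integral>\<^sup>+t. ennreal (t powr (z - 1) * (- ln t / (1 - t))) * indicator {0<..<1} t \<partial>lborel) = ennreal (Polygamma 1 z)"
proof -
  have "(\<integral>\<^sup>+t. ennreal (t powr (z - 1) * (- ln t / (1 - t))) * indicator {0<..<1} t \<partial>lborel) =
        (\<integral>\<^sup>+t. (\<Sum>n. ennreal ((- ln t) powr (2 - 1) * t powr (z + real n - 1)) * indicator {0<..<1} t) \<partial>lborel)"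
  proof (intro nn_integral_cong)
    fix t :: real
    show "ennreal (t powr (z - 1) * (- ln t / (1 - t))) * indicator {0<..<1} t =
          (\<Sum>n. ennreal ((- ln t) powr (2 - 1) * t powr (z + real n - 1)) * indicator {0<..<1} t)"
    proof (cases "t \<in> {0<..<1}")
      case True
      then have t: "0 < t" "t < 1" by auto
      have "(\<lambda>n. (t powr (z - 1) * (- ln t)) * t ^ n) sums (t powr (z - 1) * (- ln t) * (1 / (1 - t)))"
        using t by (intro sums_mult geometric_sums) auto
      moreover have "(t powr (z - 1) * (- ln t)) * t ^ n = (- ln t) powr (2 - 1) * t powr (z + real n - 1)" for n
      proof -
        have "t powr (z + real n - 1) = t powr (z - 1) * t powr real n"
          by (simp add: powr_add[symmetric] algebra_simps)
        moreover have "t powr real n = t ^ n" using t by (simp add: powr_realpow)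
        moreover have "(- ln t) powr (2 - 1) = - ln t" using t by simp
        ultimately show ?thesis by (simp only: mult_ac)
      qed
      ultimately have "(\<lambda>n. (- ln t) powr (2 - 1) * t powr (z + real n - 1)) sums (t powr (z - 1) * (- ln t / (1 - t)))"
        by (simp only: times_divide_eq_right mult_1_right)
      then have "(\<Sum>n. ennreal ((- ln t) powr (2 - 1) * t powr (z + real n - 1))) = ennreal (t powr (z - 1) * (- ln t / (1 - t)))"
        by (intro suminf_ennreal_eq) auto
      with True show ?thesis by simp
    qed simp
  qed
  also have "\<dots> = (\<Sum>n. \<integral>\<^sup>+t. ennreal ((- ln t) powr (2 - 1) * t powr (z + real n - 1)) * indicator {0<..<1} t \<partial>lborel)"
    by (intro nn_integral_suminf) measurable
  also have "\<dots> = (\<Sum>n. ennreal (1 / (z + real n) ^ 2))"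
  proof (intro suminf_cong)
    fix n
    have "(\<integral>\<^sup>+t. ennreal ((- ln t) powr (2 - 1) * t powr (z + real n - 1)) * indicator {0<..<1} t \<partial>lborel) =
        ennreal (Gamma 2 / (z + real n) powr 2)"
      using z by (intro nn_integral_neg_ln_powr) auto
    also have "Gamma 2 / (z + real n) powr 2 = 1 / (z + real n) ^ 2"
      using z Gamma_fact[of 1, where 'a = real] by (simp add: powr_numeral)
    finally show "(\<integral>\<^sup>+t. ennreal ((- ln t) powr (2 - 1) * t powr (z + real n - 1)) * indicator {0<..<1} t \<partial>lborel) =
        ennreal (1 / (z + real n) ^ 2)" .
  qed
  also have "\<dots> = ennreal (Polygamma 1 z)"
    using trigamma_sums[of z] z by (intro suminf_ennreal_eq) auto
  finally show ?thesis .
qed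

lemma alpha_series_trigamma_real:
  fixes s :: real
  assumes s: "s \<ge> 1"
  shows "(\<lambda>k. alpha k (of_real s) * Polygamma 1 (of_real s + of_nat k)) sums (Gamma (of_real s) * zeta (of_real s + 1))"
proof -
  define Z where "Z = (\<Sum>m. real (Suc m) powr (- (s + 1)))"
  have "summable (\<lambda>m. real m powr (- (s + 1)))"
    using s by (subst summable_real_powr_iff) auto
  then have "summable (\<lambda>m. real (Suc m) powr (- (s + 1)))"
    by (subst summable_Suc_iff)
  then have Z: "(\<lambda>m. real (Suc m) powr (- (s + 1))) sums Z"
    unfolding Z_def by (rule summable_sums)
  have "(\<lambda>k. Re (alpha k (of_real s)) * Polygamma 1 (s + real k)) sums (Gamma s * Z)"
  proof (rule alpha_series_of_weight[of s "\<lambda>m. 1 / real (Suc m)" "\<lambda>t. - ln t / (1 - t)"])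
    show "(\<lambda>m. 1 / real (Suc m) * (1 - t) ^ m) sums (- ln t / (1 - t))" if "0 < t" "t < 1" for t
      using that by (rule sums_neg_ln_quotient)
    show "(\<integral>\<^sup>+t. ennreal (t powr (s + real k - 1) * (- ln t / (1 - t))) * indicator {0<..<1} t \<partial>lborel) =
        ennreal (Polygamma 1 (s + real k))" for k
      using s by (intro nn_integral_trigamma) auto
    show "0 \<le> Polygamma 1 (s + real k)" for k
      using sums_le[OF _ sums_zero trigamma_sums[of "s + real k"]] s by simp
    have "1 / real (Suc m) / real (Suc m) powr s = real (Suc m) powr (- (s + 1))" for m
    proof -
      have "real (Suc m) powr (- (s + 1)) = inverse (real (Suc m) powr s * real (Suc m) powr 1)"
        by (simp only: powr_minus powr_add)
      then show ?thesis by (simp add: divide_inverse mult.commute del: of_nat_Suc)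
    qed
    then show "(\<lambda>m. 1 / real (Suc m) / real (Suc m) powr s) sums Z"
      using Z by (simp only:)
  qed (use s in auto)
  then have "(\<lambda>k. of_real (Re (alpha k (of_real s)) * Polygamma 1 (s + real k))) sums complex_of_real (Gamma s * Z)"
    by (rule sums_of_real)
  moreover have "of_real (Re (alpha k (of_real s)) * Polygamma 1 (s + real k)) =
      alpha k (of_real s) * Polygamma 1 (of_real s + of_nat k)" for k
    using s alpha_of_real[OF s, of k] Polygamma_of_real[of "s + real k" 1, where 'a = complex] by simp
  moreover have "of_real (Gamma s * Z) = Gamma (of_real s) * zeta (of_real s + 1)"
  proof -
    have "of_real Z = zeta (of_real (s + 1))"
      using sums_unique2[OF sums_of_real[OF Z] zeta_sums_real[of "s + 1"]] s by simp
    then show ?thesis by (simp add: Gamma_complex_of_real)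
  qed
  ultimately show ?thesis by (simp only:)
qed

section \<open>Partial fractions with Stirling and Eulerian numbers\<close>

text \<open>
  From \<open>(z - 1) / (z - j - 2) = 1 + (j + 1) / (z - j - 2)\<close> and
  \<open>(z - 1) / (z - j - 1) = 1 + j / (z - j - 1)\<close>, the coefficient of \<open>1 / (z - j - 1)\<close> on the right is
  given by the recurrence of the Stirling numbers.
\<close>
lemma stirling_partial_fraction_Suc:
  fixes z :: complex
  defines "P \<equiv> \<lambda>l z. \<Sum>j=1..l. (-1) ^ (l + j) * (fact j * of_nat (Stirling l j) / (z - of_nat j - 1))"
  assumes l: "l \<ge> 1" and z: "\<And>i. i \<in> {2..l+2} \<Longrightarrow> z \<noteq> of_nat i"
  shows "P (Suc l) z = (z - 1) * (P l (z - 1) - P l z)"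
proof -
  define c :: "nat \<Rightarrow> nat \<Rightarrow> complex"
    where "c = (\<lambda>l j. (-1) ^ (l + j) * (fact j * of_nat (Stirling l j)))"
  have c0: "c k 0 = 0" if "k \<ge> 1" for k
    using that by (cases k) (auto simp: c_def)
  have P: "P k w = (\<Sum>j\<le>k. c k j / (w - of_nat j - 1))" if "k \<ge> 1" for k w
  proof -
    have "(\<Sum>j=1..k. c k j / (w - of_nat j - 1)) = (\<Sum>j\<le>k. c k j / (w - of_nat j - 1))"
      using c0[OF that] by (intro sum.mono_neutral_left) (auto simp: not_less_eq_eq)
    then show ?thesis by (simp add: P_def c_def mult_ac)
  qed
  have c_Suc: "c (Suc l) (Suc j) = of_nat (Suc j) * c l j - of_nat (Suc j) * c l (Suc j)" for j
    by (simp add: c_def algebra_simps)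
  have "P (Suc l) z = (\<Sum>j\<le>Suc l. c (Suc l) j / (z - of_nat j - 1))"
    by (rule P) simp
  also have "\<dots> = (\<Sum>j\<le>l. c (Suc l) (Suc j) / (z - of_nat (Suc j) - 1))"
    by (subst sum.atMost_Suc_shift) (simp add: c0)
  also have "\<dots> = (\<Sum>j\<le>l. of_nat (Suc j) * c l j / (z - of_nat (Suc j) - 1)) -
                  (\<Sum>j\<le>l. of_nat (Suc j) * c l (Suc j) / (z - of_nat (Suc j) - 1))"
    unfolding c_Suc by (simp only: diff_divide_distrib sum_subtractf)
  also have "(\<Sum>j\<le>l. of_nat (Suc j) * c l (Suc j) / (z - of_nat (Suc j) - 1)) =
             (\<Sum>j\<le>Suc l. of_nat j * c l j / (z - of_nat j - 1))"
    by (simp only: sum.atMost_Suc_shift) simp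
  also have "\<dots> = (\<Sum>j\<le>l. of_nat j * c l j / (z - of_nat j - 1))"
    by (simp add: c_def)
  also have "(\<Sum>j\<le>l. of_nat (Suc j) * c l j / (z - of_nat (Suc j) - 1)) -
             (\<Sum>j\<le>l. of_nat j * c l j / (z - of_nat j - 1)) =
             (\<Sum>j\<le>l. (z - 1) * (c l j / (z - 1 - of_nat j - 1) - c l j / (z - of_nat j - 1)))"
    unfolding sum_subtractf[symmetric]
  proof (intro sum.cong refl)
    fix j assume j: "j \<in> {..l}"
    show "of_nat (Suc j) * c l j / (z - of_nat (Suc j) - 1) - of_nat j * c l j / (z - of_nat j - 1) =
          (z - 1) * (c l j / (z - 1 - of_nat j - 1) - c l j / (z - of_nat j - 1))"
    proof (cases "j = 0")
      case True
      then show ?thesis using c0[OF l] by simp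
    next
      case False
      have nz: "z - of_nat j - 1 \<noteq> 0" "z - of_nat j - 2 \<noteq> 0"
        using z[of "j + 1"] z[of "j + 2"] j False by (auto simp: algebra_simps)
      have "of_nat (Suc j) / (z - of_nat j - 2) - of_nat j / (z - of_nat j - 1) =
            (z - 1) * (1 / (z - of_nat j - 2) - 1 / (z - of_nat j - 1))"
        using nz by (simp add: divide_simps) (simp add: algebra_simps)
      from arg_cong[OF this, of "\<lambda>x. c l j * x"] show ?thesis
        by (simp add: algebra_simps)
    qed
  qed
  also have "\<dots> = (z - 1) * (P l (z - 1) - P l z)"
    unfolding P[OF l] sum_subtractf[symmetric] sum_distrib_left ..
  finally show ?thesis .
qed

text \<open>
  The summand with index \<open>j\<close> on the right splits into multiples \<open>j + 1\<close> and \<open>l - j\<close> of the summands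
  with indices \<open>j\<close> and \<open>j + 1\<close> on the left, exactly as in the recurrence of the Eulerian
  numbers.
\<close>
lemma eulerian_partial_fraction_Suc:
  fixes z :: complex
  defines "Q \<equiv> \<lambda>l z. \<Sum>j<l. of_nat (eulerian l j) * (fact (l - j - 1) / (\<Prod>i=j+2..l+1. z - of_nat i))"
  assumes l: "l \<ge> 1" and z: "\<And>i. i \<in> {2..l+2} \<Longrightarrow> z \<noteq> of_nat i"
  shows "Q (Suc l) z = (z - 1) * (Q l (z - 1) - Q l z)"
proof -
  define T :: "nat \<Rightarrow> nat \<Rightarrow> complex \<Rightarrow> complex"
    where "T = (\<lambda>l j z. fact (l - j - 1) / (\<Prod>i=j+2..l+1. z - of_nat i))"
  have T: "(z - 1) * (T l j (z - 1) - T l j z) =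
           of_nat (j + 1) * T (Suc l) j z + of_nat (l - j) * T (Suc l) (Suc j) z" if j: "j < l" for j
  proof -
    define q where "q = (\<Prod>i=j+3..l+1. z - of_nat i)"
    define a where "a = z - of_nat j - 2"
    define b where "b = z - of_nat l - 2"
    have q: "q \<noteq> 0"
      unfolding q_def
    proof (subst prod_zero_iff, simp, safe)
      fix i assume "i \<in> {j+3..l+1}" "z - of_nat i = 0"
      then show False using z[of i] by simp
    qed
    have ab: "a \<noteq> 0" "b \<noteq> 0"
      using z[of "j + 2"] z[of "l + 2"] j by (auto simp: a_def b_def algebra_simps)
    have p1: "(\<Prod>i=j+2..l+1. z - of_nat i) = a * q"
      using j by (subst prod.atLeast_Suc_atMost) (auto simp: a_def q_def algebra_simps numeral_3_eq_3)
    have p3: "(\<Prod>i=j+3..Suc l+1. z - of_nat i) = q * b"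
      using j by (simp add: q_def b_def algebra_simps)
    have "(\<Prod>i=j+2..l+1. z - 1 - of_nat i) = (\<Prod>i=Suc (j+2)..Suc (l+1). z - of_nat i)"
      by (subst prod.atLeast_Suc_atMost_Suc_shift) (simp add: algebra_simps)
    also have "\<dots> = q * b" using p3 by (simp add: numeral_3_eq_3)
    finally have p2: "(\<Prod>i=j+2..l+1. z - 1 - of_nat i) = q * b" .
    have "(\<Prod>i=j+2..Suc l+1. z - of_nat i) = (\<Prod>i=j+2..l+1. z - of_nat i) * (z - of_nat (l + 2))"
      using j by simp
    then have p4: "(\<Prod>i=j+2..Suc l+1. z - of_nat i) = a * q * b"
      unfolding p1 by (simp add: b_def algebra_simps)
    define F :: complex where "F = fact (l - j - 1)"
    have F: "fact (l - j) = of_nat (l - j) * F"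
      using j by (simp add: F_def fact_reduce)
    have lj: "of_nat (l - j) = a - b"
      using j by (simp add: a_def b_def of_nat_diff)
    have zz: "z = a + of_nat j + 2" by (simp add: a_def)
    have "(z - 1) * (F / (q * b) - F / (a * q)) =
          of_nat (j + 1) * ((a - b) * F / (a * q * b)) + (a - b) * (F / (q * b))"
      using q ab unfolding zz by (simp add: divide_simps) (simp add: algebra_simps)
    moreover have "T l j (z - 1) = F / (q * b)" "T l j z = F / (a * q)"
      unfolding T_def p1 p2 F_def by simp_all
    moreover have "T (Suc l) j z = (a - b) * F / (a * q * b)"
      unfolding T_def p4 using F lj j by (simp add: Suc_diff_le)
    moreover have "T (Suc l) (Suc j) z = F / (q * b)"
      using p3 by (simp add: T_def F_def numeral_3_eq_3)
    ultimately show ?thesis using lj by simp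
  qed
  have E: "of_nat (eulerian (Suc l) j) = of_nat (j + 1) * of_nat (eulerian l j) +
      (if j = 0 then 0 else of_nat (l + 1 - j) * of_nat (eulerian l (j - 1)) :: complex)" for j
  proof -
    obtain n where "l = Suc n" using l by (cases l) auto
    then show ?thesis by (simp add: distrib_right)
  qed
  have "Q (Suc l) z = (\<Sum>j<Suc l. of_nat (eulerian (Suc l) j) * T (Suc l) j z)"
    by (simp add: Q_def T_def)
  also have "\<dots> = (\<Sum>j<Suc l. of_nat (j + 1) * of_nat (eulerian l j) * T (Suc l) j z) +
      (\<Sum>j<Suc l. (if j = 0 then 0 else of_nat (l + 1 - j) * of_nat (eulerian l (j - 1))) * T (Suc l) j z)"
    unfolding E by (simp only: sum.distrib[symmetric] distrib_right)
  also have "(\<Sum>j<Suc l. of_nat (j + 1) * of_nat (eulerian l j) * T (Suc l) j z) =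
      (\<Sum>j<l. of_nat (j + 1) * of_nat (eulerian l j) * T (Suc l) j z)"
    by (simp add: eulerian_eq_0)
  also have "(\<Sum>j<Suc l. (if j = 0 then 0 else of_nat (l + 1 - j) * of_nat (eulerian l (j - 1))) * T (Suc l) j z) =
      (\<Sum>j<l. of_nat (l - j) * of_nat (eulerian l j) * T (Suc l) (Suc j) z)"
    by (subst sum.lessThan_Suc_shift) simp
  also have "(\<Sum>j<l. of_nat (j + 1) * of_nat (eulerian l j) * T (Suc l) j z) + \<dots> =
      (\<Sum>j<l. of_nat (eulerian l j) * (of_nat (j + 1) * T (Suc l) j z + of_nat (l - j) * T (Suc l) (Suc j) z))"
    unfolding sum.distrib[symmetric] by (intro sum.cong refl) (simp only: distrib_left mult_ac)
  also have "\<dots> = (\<Sum>j<l. of_nat (eulerian l j) * ((z - 1) * (T l j (z - 1) - T l j z)))"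
    by (intro sum.cong refl) (simp add: T)
  also have "\<dots> = (z - 1) * (Q l (z - 1) - Q l z)"
    unfolding Q_def T_def sum_subtractf[symmetric] sum_distrib_left
    by (intro sum.cong refl) (simp add: algebra_simps)
  finally show ?thesis .
qed

lemma stirling_eq_eulerian_partial_fraction:
  fixes z :: complex
  assumes "l \<ge> 1" and "\<And>i. i \<in> {2..l+1} \<Longrightarrow> z \<noteq> of_nat i"
  shows "(\<Sum>j=1..l. (-1) ^ (l + j) * (fact j * of_nat (Stirling l j) / (z - of_nat j - 1))) =
         (\<Sum>j=0..l-1. of_nat (eulerian l j) * (fact (l - j - 1) / (\<Prod>i=j+2..l+1. z - of_nat i)))"
proof -
  have "(\<Sum>j=1..l. (-1) ^ (l + j) * (fact j * of_nat (Stirling l j) / (z - of_nat j - 1))) =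
        (\<Sum>j<l. of_nat (eulerian l j) * (fact (l - j - 1) / (\<Prod>i=j+2..l+1. z - of_nat i)))"
    using assms
  proof (induction l arbitrary: z rule: nat_induct_at_least)
    case base
    then show ?case by (simp add: algebra_simps numeral_2_eq_2)
  next
    case (Suc l)
    have z: "z \<noteq> of_nat i" if "i \<in> {2..l+2}" for i
      using Suc.prems[of i] that by simp
    have "z - 1 \<noteq> of_nat i" if "i \<in> {2..l+1}" for i
      using z[of "i + 1"] that by (auto simp: algebra_simps)
    note IH1 = Suc.IH[OF this]
    have "z \<noteq> of_nat i" if "i \<in> {2..l+1}" for i
      using z[of i] that by simp
    note IH2 = Suc.IH[OF this]
    show ?case
      by (simp only: stirling_partial_fraction_Suc[OF Suc.hyps z]
          eulerian_partial_fraction_Suc[OF Suc.hyps z] IH1 IH2)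
  qed
  also have "{..<l} = {0..l-1}" using assms(1) by auto
  finally show ?thesis .
qed

section \<open>The identities on their full domains\<close>

lemma not_nonpos_Int_imp_off_integers: "s \<notin> \<int>\<^sub>\<le>\<^sub>0 \<Longrightarrow> s \<in> off_integers_upto 0"
  by (auto simp: off_integers_upto_def nonpos_Ints_of_int)

lemma holomorphic_shift:
  assumes "d \<le> c"
  shows "(\<lambda>s. 1 / (s + of_nat k - of_int d)) holomorphic_on off_integers_upto c"
proof (intro holomorphic_intros)
  fix s assume s: "s \<in> off_integers_upto c"
  then have "s \<noteq> of_int (d - int k)"
    using assms by (intro off_integers_upto_neq[OF s]) auto
  then show "s + of_nat k - of_int d \<noteq> 0"
    by (auto simp: algebra_simps)
qed

text \<open>
  The condition \<open>1 - d \<le> c\<close> places the pole of the zeta factor among the removed points.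
\<close>
lemma holomorphic_Gamma_zeta:
  assumes "c \<ge> 0" "1 - d \<le> c"
  shows "(\<lambda>s. Gamma s * zeta (s + of_int d)) holomorphic_on off_integers_upto c"
proof (intro holomorphic_on_mult holomorphic_Gamma)
  show "off_integers_upto c \<inter> \<int>\<^sub>\<le>\<^sub>0 = {}"
    using off_integers_upto_not_nonpos_Ints assms(1) by blast
  have "(zeta \<circ> (\<lambda>s. s + of_int d)) holomorphic_on off_integers_upto c"
  proof (rule holomorphic_on_compose_gen[OF _ zeta_holomorphic])
    show "(\<lambda>s. s + of_int d) ` off_integers_upto c \<subseteq> - {1}"
    proof (clarify, simp)
      fix s :: complex assume "s \<in> off_integers_upto c" "s + of_int d = 1"
      then show False
        using off_integers_upto_neq[of s c "1 - d"] assms(2) by (simp add: algebra_simps)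
    qed
  qed (intro holomorphic_intros)
  then show "(\<lambda>s. zeta (s + of_int d)) holomorphic_on off_integers_upto c"
    by (simp add: o_def)
qed

lemma Gamma_series:
  assumes "s \<notin> \<int>\<^sub>\<le>\<^sub>0"
  shows "(\<lambda>k. alpha k s / (s + of_nat k)) sums Gamma s"
proof -
  have "(\<lambda>k. alpha k s * (1 / (s + of_nat k - of_int 0))) sums Gamma s"
  proof (rule alpha_series_continuation[where S = "off_integers_upto 0" and N = 1])
    show "inverse_linear_decay (\<lambda>k s. 1 / (s + of_nat k - of_int 0))"
      by (rule inverse_linear_decay_shift)
    show "Gamma holomorphic_on off_integers_upto 0"
      by (intro holomorphic_Gamma) (use off_integers_upto_not_nonpos_Ints in blast)
    fix x :: real assume x: "x > 1"
    then show "complex_of_real x \<in> off_integers_upto 0"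
      by (intro of_real_in_off_integers_upto) auto
    have "(\<lambda>k. of_real (Re (alpha k (of_real x)) / (x + real k))) sums complex_of_real (Gamma x)"
      using x by (intro sums_of_real Gamma_series_real) auto
    moreover have "of_real (Re (alpha k (of_real x)) / (x + real k)) =
        alpha k (of_real x) * (1 / (of_real x + of_nat k - of_int 0))" for k
      using x by (subst (2) alpha_of_real) auto
    ultimately show "(\<lambda>k. alpha k (of_real x) * (1 / (of_real x + of_nat k - of_int 0))) sums Gamma (of_real x)"
      by (simp only: Gamma_complex_of_real)
  qed (use assms not_nonpos_Int_imp_off_integers holomorphic_shift[of 0 0] open_off_integers_upto
         connected_off_integers_upto in auto)
  then show ?thesis by simp
qed

lemma Gamma_zeta_series:
  assumes "s \<noteq> 1" "s \<notin> \<int>\<^sub>\<le>\<^sub>0"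
  shows "(\<lambda>k. alpha k s / (s + of_nat k - 1)) sums (Gamma s * zeta s)"
proof -
  have s: "s \<in> off_integers_upto 1"
    unfolding off_integers_upto_def
  proof safe
    fix m :: int assume m: "m \<le> 1" "s = of_int m"
    show False
    proof (cases "m = 1")
      case False
      with m assms show False by (auto simp: nonpos_Ints_of_int)
    qed (use m assms in auto)
  qed
  have "(\<lambda>k. alpha k s * (1 / (s + of_nat k - of_int 1))) sums (Gamma s * zeta (s + of_int 0))"
  proof (rule alpha_series_continuation[where S = "off_integers_upto 1" and N = 1
        and R = "\<lambda>k s. 1 / (s + of_nat k - of_int 1)" and H = "\<lambda>s. Gamma s * zeta (s + of_int 0)"])
    show "inverse_linear_decay (\<lambda>k s. 1 / (s + of_nat k - of_int 1))"
      by (rule inverse_linear_decay_shift)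
    show "(\<lambda>s. Gamma s * zeta (s + of_int 0)) holomorphic_on off_integers_upto 1"
      by (rule holomorphic_Gamma_zeta) auto
    fix x :: real assume x: "x > 1"
    then show "complex_of_real x \<in> off_integers_upto 1"
      by (intro of_real_in_off_integers_upto) auto
    define Z where "Z = (\<Sum>m. real (m choose 0) / real (Suc m) powr x)"
    have "(\<lambda>m. 1 / real (Suc m) powr x) sums Z"
      using summable_binomial_powr[of 0 x] x by (simp add: Z_def summable_sums)
    then have "(\<lambda>m. of_real (real (Suc m) powr (- x))) sums complex_of_real Z"
      by (intro sums_of_real) (simp add: powr_minus inverse_eq_divide del: of_nat_Suc)
    then have "of_real Z = zeta (of_real x)"
      using zeta_sums_real[OF x] by (rule sums_unique2)
    then show "(\<lambda>k. alpha k (of_real x) * (1 / (of_real x + of_nat k - of_int 1))) sums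
        (Gamma (of_real x) * zeta (of_real x + of_int 0))"
      using alpha_series_pole_real[of 0 x] x by (simp add: Z_def Gamma_complex_of_real)
  qed (use s holomorphic_shift[of 1 1] open_off_integers_upto connected_off_integers_upto in auto)
  then show ?thesis by simp
qed

lemma Gamma_zeta_Stirling_series:
  assumes l: "l \<ge> 1" and s: "s \<in> off_integers_upto (int l + 1)"
  shows "(\<lambda>k. alpha k s *
           (\<Sum>j=1..l. (-1) ^ (l + j) *
              (fact j * of_nat (Stirling l j) / (s + of_nat k - of_nat j - 1))))
          sums (Gamma s * zeta (s - of_nat l))"
proof -
  define R :: "nat \<Rightarrow> complex \<Rightarrow> complex" where
    "R = (\<lambda>k s. \<Sum>j=1..l. (-1) ^ (l + j) * (fact j * of_nat (Stirling l j) / (s + of_nat k - of_nat j - 1)))"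
  have R: "R = (\<lambda>k s. \<Sum>j=1..l. ((-1) ^ (l + j) * fact j * of_nat (Stirling l j)) *
                  (1 / (s + of_nat k - of_int (int j + 1))))"
    unfolding R_def by (intro ext sum.cong refl) (simp add: algebra_simps)
  have "(\<lambda>k. alpha k s * R k s) sums (Gamma s * zeta (s + of_int (- int l)))"
  proof (rule alpha_series_continuation[where S = "off_integers_upto (int l + 1)" and N = "real l + 1"
        and H = "\<lambda>s. Gamma s * zeta (s + of_int (- int l))"])
    show "inverse_linear_decay R"
      unfolding R by (intro inverse_linear_decay_sum inverse_linear_decay_mult inverse_linear_decay_shift) auto
    show "R k holomorphic_on off_integers_upto (int l + 1)" for k
      unfolding R by (intro holomorphic_intros holomorphic_shift) auto
    show "(\<lambda>s. Gamma s * zeta (s + of_int (- int l))) holomorphic_on off_integers_upto (int l + 1)"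
      by (rule holomorphic_Gamma_zeta) auto
    fix x :: real assume x: "x > real l + 1"
    then show "complex_of_real x \<in> off_integers_upto (int l + 1)"
      by (intro of_real_in_off_integers_upto) auto
    show "(\<lambda>k. alpha k (of_real x) * R k (of_real x)) sums (Gamma (of_real x) * zeta (of_real x + of_int (- int l)))"
      using alpha_series_Stirling_real[OF l x] by (simp add: R_def)
  qed (use s open_off_integers_upto connected_off_integers_upto in auto)
  then show ?thesis by (simp add: R_def)
qed

lemma Gamma_zeta_trigamma_series:
  assumes "s \<notin> \<int>\<^sub>\<le>\<^sub>0"
  shows "(\<lambda>k. alpha k s * Polygamma 1 (s + of_nat k)) sums (Gamma s * zeta (s + 1))"
proof -
  have "(\<lambda>k. alpha k s * Polygamma 1 (s + of_nat k)) sums (Gamma s * zeta (s + of_int 1))"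
  proof (rule alpha_series_continuation[where S = "off_integers_upto 0" and N = 1
        and R = "\<lambda>k s. Polygamma 1 (s + of_nat k)" and H = "\<lambda>s. Gamma s * zeta (s + of_int 1)"])
    show "inverse_linear_decay (\<lambda>k s. Polygamma 1 (s + of_nat k))"
      by (rule inverse_linear_decay_trigamma)
    show "(\<lambda>s. Polygamma 1 (s + of_nat k)) holomorphic_on off_integers_upto 0" for k
    proof -
      have "(Polygamma 1 \<circ> (\<lambda>s. s + of_nat k)) holomorphic_on off_integers_upto 0"
      proof (rule holomorphic_on_compose_gen[of _ _ _ "- \<int>\<^sub>\<le>\<^sub>0"])
        show "(\<lambda>s. s + of_nat k) ` off_integers_upto 0 \<subseteq> - \<int>\<^sub>\<le>\<^sub>0"
        proof safe
          fix s :: complex assume s: "s \<in> off_integers_upto 0" "s + of_nat k \<in> \<int>\<^sub>\<le>\<^sub>0"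
          then obtain m where "m \<le> 0" "s + of_nat k = of_int m" by (auto elim!: nonpos_Ints_cases)
          then show False
            using off_integers_upto_neq[OF s(1), of "m - int k"] by (simp add: algebra_simps)
        qed
      qed (auto intro!: holomorphic_intros)
      then show ?thesis by (simp add: o_def)
    qed
    show "(\<lambda>s. Gamma s * zeta (s + of_int 1)) holomorphic_on off_integers_upto 0"
      by (rule holomorphic_Gamma_zeta) auto
    fix x :: real assume x: "x > 1"
    then show "complex_of_real x \<in> off_integers_upto 0"
      by (intro of_real_in_off_integers_upto) auto
    show "(\<lambda>k. alpha k (of_real x) * Polygamma 1 (of_real x + of_nat k)) sums (Gamma (of_real x) * zeta (of_real x + of_int 1))"
      using alpha_series_trigamma_real[of x] x by simp
  qed (use assms not_nonpos_Int_imp_off_integers open_off_integers_upto connected_off_integers_upto in auto)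
  then show ?thesis by simp
qed

theorem theorem1p2:
  shows
    "(\<forall>s::complex. s \<notin> \<int>\<^sub>\<le>\<^sub>0 \<longrightarrow>
        (\<lambda>k. alpha k s / (s + of_nat k)) sums Gamma s)
   \<and> (\<forall>s::complex. s \<noteq> 1 \<and> s \<notin> \<int>\<^sub>\<le>\<^sub>0 \<longrightarrow>
        (\<lambda>k. alpha k s / (s + of_nat k - 1)) sums (Gamma s * zeta s))
   \<and> (\<forall>(l::nat) (s::complex). l \<ge> 1 \<and> (\<forall>m::int. m \<le> int l + 1 \<longrightarrow> s \<noteq> of_int m) \<longrightarrow>
        (\<lambda>k. alpha k s *
           (\<Sum>j=1..l. (-1) ^ (l + j) *
              (fact j * of_nat (Stirling l j) / (s + of_nat k - of_nat j - 1))))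
          sums (Gamma s * zeta (s - of_nat l))
      \<and> (\<lambda>k. alpha k s *
           (\<Sum>j=0..l-1. of_nat (eulerian l j) *
              (fact (l - j - 1) / (\<Prod>i=j+2..l+1. s + of_nat k - of_nat i))))
          sums (Gamma s * zeta (s - of_nat l)))
   \<and> (\<forall>s::complex. s \<notin> \<int>\<^sub>\<le>\<^sub>0 \<longrightarrow>
        (\<lambda>k. alpha k s * Polygamma 1 (s + of_nat k)) sums (Gamma s * zeta (s + 1))
      \<and> (\<forall>k. summable (\<lambda>n. alpha k s / (s + of_nat k + of_nat n) ^ 2))
      \<and> (\<lambda>k. \<Sum>n. alpha k s / (s + of_nat k + of_nat n) ^ 2) sums (Gamma s * zeta (s + 1)))"
proof (intro conjI allI impI)
  fix s :: complex
  assume "s \<notin> \<int>\<^sub>\<le>\<^sub>0"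
  then show "(\<lambda>k. alpha k s / (s + of_nat k)) sums Gamma s"
    by (rule Gamma_series)
next
  fix s :: complex
  assume "s \<noteq> 1 \<and> s \<notin> \<int>\<^sub>\<le>\<^sub>0"
  then show "(\<lambda>k. alpha k s / (s + of_nat k - 1)) sums (Gamma s * zeta s)"
    using Gamma_zeta_series by blast
next
  fix l :: nat and s :: complex
  assume asm: "l \<ge> 1 \<and> (\<forall>m::int. m \<le> int l + 1 \<longrightarrow> s \<noteq> of_int m)"
  then have l: "l \<ge> 1" and s: "s \<in> off_integers_upto (int l + 1)"
    by (auto simp: off_integers_upto_def)
  show stirling: "(\<lambda>k. alpha k s *
           (\<Sum>j=1..l. (-1) ^ (l + j) *
              (fact j * of_nat (Stirling l j) / (s + of_nat k - of_nat j - 1))))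
          sums (Gamma s * zeta (s - of_nat l))"
    using l s by (rule Gamma_zeta_Stirling_series)
  have "(\<Sum>j=1..l. (-1) ^ (l + j) *
              (fact j * of_nat (Stirling l j) / (s + of_nat k - of_nat j - 1))) =
        (\<Sum>j=0..l-1. of_nat (eulerian l j) *
              (fact (l - j - 1) / (\<Prod>i=j+2..l+1. s + of_nat k - of_nat i)))" for k
  proof (rule stirling_eq_eulerian_partial_fraction[OF l])
    fix i assume "i \<in> {2..l+1}"
    then have "int i - int k \<le> int l + 1"
      by auto
    then have "s \<noteq> of_int (int i - int k)"
      using asm by blast
    then show "s + of_nat k \<noteq> of_nat i"
      by (auto simp: algebra_simps)
  qed
  with stirling show "(\<lambda>k. alpha k s *
           (\<Sum>j=0..l-1. of_nat (eulerian l j) *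
              (fact (l - j - 1) / (\<Prod>i=j+2..l+1. s + of_nat k - of_nat i))))
          sums (Gamma s * zeta (s - of_nat l))"
    by (simp only:)
next
  fix s :: complex
  assume s: "s \<notin> \<int>\<^sub>\<le>\<^sub>0"
  show series: "(\<lambda>k. alpha k s * Polygamma 1 (s + of_nat k)) sums (Gamma s * zeta (s + 1))"
    using s by (rule Gamma_zeta_trigamma_series)
  have nz: "s + of_nat k \<noteq> 0" for k
    using s by (metis add_eq_0_iff2 minus_of_nat_in_nonpos_Ints)
  have inner: "(\<lambda>n. alpha k s / (s + of_nat k + of_nat n) ^ 2) sums (alpha k s * Polygamma 1 (s + of_nat k))" for k
    using sums_mult[OF trigamma_sums[OF nz[of k]], of "alpha k s"] by simp
  then show "summable (\<lambda>n. alpha k s / (s + of_nat k + of_nat n) ^ 2)" for k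
    by (rule sums_summable)
  show "(\<lambda>k. \<Sum>n. alpha k s / (s + of_nat k + of_nat n) ^ 2) sums (Gamma s * zeta (s + 1))"
    using series sums_unique[OF inner] by simp
qed

end
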